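(* Let $d>0$, $\varepsilon>0$ and an integer $k\ge2$ be constants. For $n,\ell\in\mathbb{N}$ let $$R_{n,\ell}=\max_{p\in\mathbb{R}[x]_{\le\ell}}\ \frac{\mathbb{E}_{x\sim \mathrm{SBM}(n,d,\varepsilon,k)}\,p(x)}{\big(\mathbb{E}_{x\sim G(n,d/n)}\,p(x)^2\big)^{1/2}},$$ where the maximum is over polynomials $p$ of degree at most $\ell$ in the entries of the adjacency matrix $x$ for which the denominator is nonzero. Then: 1. If $\varepsilon^2d>k^2$, there are constants $C,c>0$ (depending on $d,\varepsilon,k$) such that $R_{n,\ell}\ge n^{c}$ for all sufficiently large $n$ and all $\ell\ge C\log n$. 2. If $\varepsilon^2d<k^2$ and $\ell=\ell(n)\le n^{o(1)}$, then $R_{n,\ell(n)}\le n^{o(1)}$ as $n\to\infty$.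
   Context: Graphs on $[n]$ are represented by adjacency matrices $x\in\{0,1\}^{n\times n}$. $\mathrm{SBM}(n,d,\varepsilon,k)$ is the $k$-community stochastic block model: draw $\sigma\in[k]^n$ uniformly; independently for each pair $i\neq j$, add the edge $\{i,j\}$ with probability $(1+(1-\frac1k)\varepsilon)\frac dn$ if $\sigma_i=\sigma_j$ and with probability $(1-\frac{\varepsilon}{k})\frac dn$ otherwise (parameters are such that these are valid probabilities for large $n$). $G(n,d/n)$ is the Erdős–Rényi random graph with edge probability $d/n$. $\mathbb{R}[x]_{\le\ell}$ is the set of real polynomials of degree at most $\ell$ in the entries of $x$. *)

theory Defs
  imports "HOL-Probability.Probability" "HOL-Library.Poly_Mapping"
begin

text \<open>
  The vertex set is \<open>{..<n}\<close> and the set of communities is \<open>{..<k}\<close>.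
  An adjacency matrix is a function on index pairs, with value 0 outside
  \<open>{..<n} \<times> {..<n}\<close>.
\<close>

type_synonym matrix_real = "nat \<times> nat \<Rightarrow> real"

definition vertex_pairs :: "nat \<Rightarrow> (nat \<times> nat) set" where
  "vertex_pairs n = {(i, j). i < j \<and> j < n}"

text \<open>
  An unordered pair is represented by its increasing enumeration. If \<open>e\<close> is
  \<open>False\<close> outside \<^term>\<open>vertex_pairs n\<close>, the result is symmetric with zero diagonal.
\<close>

definition adjacency_matrix :: "(nat \<times> nat \<Rightarrow> bool) \<Rightarrow> matrix_real" where
  "adjacency_matrix e = (\<lambda>(i, j). of_bool (e (min i j, max i j)))"

definition independent_edges :: "nat \<Rightarrow> (nat \<Rightarrow> nat \<Rightarrow> real) \<Rightarrow> matrix_real pmf" where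
  "independent_edges n q =
     map_pmf adjacency_matrix
       (Pi_pmf (vertex_pairs n) False (\<lambda>(i, j). bernoulli_pmf (q i j)))"

text \<open>
  \<^const>\<open>bernoulli_pmf\<close> truncates its parameter to the unit interval, so the two models
  below are total; they have their intended meaning when the edge probabilities lie
  in \<open>{0..1}\<close>.
\<close>

definition erdos_renyi :: "nat \<Rightarrow> real \<Rightarrow> matrix_real pmf" where
  "erdos_renyi n p = independent_edges n (\<lambda>_ _. p)"

definition sbm_edge_prob :: "nat \<Rightarrow> real \<Rightarrow> real \<Rightarrow> nat \<Rightarrow> bool \<Rightarrow> real" where
  "sbm_edge_prob n d \<epsilon> k same =
     (if same then (1 + (1 - 1 / real k) * \<epsilon>) * (d / real n)
      else (1 - \<epsilon> / real k) * (d / real n))"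

definition sbm :: "nat \<Rightarrow> real \<Rightarrow> real \<Rightarrow> nat \<Rightarrow> matrix_real pmf" where
  "sbm n d \<epsilon> k =
     bind_pmf (pmf_of_set ({..<n} \<rightarrow>\<^sub>E {..<k}))
       (\<lambda>\<sigma>. independent_edges n (\<lambda>i j. sbm_edge_prob n d \<epsilon> k (\<sigma> i = \<sigma> j)))"

text \<open>
  A polynomial maps each monomial (a finitely supported exponent function on the
  variables, here the matrix positions) to its coefficient.
\<close>

type_synonym matrix_poly = "((nat \<times> nat) \<Rightarrow>\<^sub>0 nat) \<Rightarrow>\<^sub>0 real"

definition monomial_degree :: "((nat \<times> nat) \<Rightarrow>\<^sub>0 nat) \<Rightarrow> nat" where
  "monomial_degree m = (\<Sum>v\<in>Poly_Mapping.keys m. Poly_Mapping.lookup m v)"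

definition poly_eval :: "matrix_poly \<Rightarrow> matrix_real \<Rightarrow> real" where
  "poly_eval p x = (\<Sum>m\<in>Poly_Mapping.keys p. Poly_Mapping.lookup p m * (\<Prod>v\<in>Poly_Mapping.keys m. x v ^ Poly_Mapping.lookup m v))"

definition polys_degree_le :: "nat \<Rightarrow> nat \<Rightarrow> matrix_poly set" where
  "polys_degree_le n l =
     {p. \<forall>m\<in>Poly_Mapping.keys p. Poly_Mapping.keys m \<subseteq> {..<n} \<times> {..<n} \<and> monomial_degree m \<le> l}"

definition low_degree_ratio :: "nat \<Rightarrow> real \<Rightarrow> real \<Rightarrow> nat \<Rightarrow> matrix_poly \<Rightarrow> real" where
  "low_degree_ratio n d \<epsilon> k p =
     measure_pmf.expectation (sbm n d \<epsilon> k) (poly_eval p) /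
     sqrt (measure_pmf.expectation (erdos_renyi n (d / real n)) (\<lambda>x. (poly_eval p x)\<^sup>2))"

definition max_low_degree_ratio :: "nat \<Rightarrow> real \<Rightarrow> real \<Rightarrow> nat \<Rightarrow> nat \<Rightarrow> real" where
  "max_low_degree_ratio n d \<epsilon> k l =
     (GREATEST r. \<exists>p\<in>polys_degree_le n l.
        measure_pmf.expectation (erdos_renyi n (d / real n)) (\<lambda>x. (poly_eval p x)\<^sup>2) \<noteq> 0 \<and>
        r = low_degree_ratio n d \<epsilon> k p)"

text \<open>The relation \<open>f n \<le> n\<^bsup>o(1)\<^esup>\<close> as \<open>n\<close> tends to infinity.\<close>

definition le_n_pow_o1 :: "(nat \<Rightarrow> real) \<Rightarrow> bool" where
  "le_n_pow_o1 f \<longleftrightarrow>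
     (\<exists>\<delta>. \<delta> \<longlonglongrightarrow> 0 \<and> (\<forall>\<^sub>F n in sequentially. f n \<le> real n powr \<delta> n))"

end

theory Submission
  imports Defs "HOL-Combinatorics.Multiset_Permutations" "HOL-Real_Asymp.Real_Asymp"
begin

text \<open>
  The products of centred edge variables over edge sets \<open>S\<close> are orthogonal under the
  Erdos-Renyi model, so the squared maximum is the sum over \<open>card S \<le> l\<close> of
  \<open>\<rho> ^ card S * G S ^ 2\<close>. Here \<open>\<rho> = \<Lambda> / (n - d)\<close> with \<open>\<Lambda> = \<epsilon>^2 * d / k^2\<close>, and \<open>G S\<close> is the mean
  over labellings of the product over \<open>S\<close> of the kernel with value \<open>k - 1\<close> on equal and \<open>- 1\<close> on
  different labels.

  If \<open>\<Lambda> > 1\<close>, cycles of length about \<open>C * ln n\<close> suffice: each has \<open>G S = k - 1\<close>, and fixing two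
  adjacent vertices costs only a factor \<open>n^2\<close>, which the growth of \<open>\<Lambda> ^ m\<close> absorbs.

  If \<open>\<Lambda> < 1\<close>, take two independent labellings. All mixed moments of the products of the two kernels
  are squares, so the sum over edge sets of size \<open>t\<close> is at most \<open>1 / t!\<close> times the \<open>t\<close>-th moment of
  half the full quadratic form. That form is the squared norm of a sum of \<open>n\<close> independent
  centred vectors in dimension \<open>k^2\<close>. A finite net of directions and a Chernoff bound
  give its moments up to the factor \<open>(1 + o(1)) ^ t\<close>, which \<open>\<Lambda> < 1\<close> absorbs.
\<close>

section \<open>The optimal polynomial\<close>

lemma finite_vertex_pairs [simp]: "finite (vertex_pairs n)"
  by (rule finite_subset[of _ "{..<n} \<times> {..<n}"]) (auto simp: vertex_pairs_def)

definition zero_one_matrices :: "nat \<Rightarrow> matrix_real set" where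
  "zero_one_matrices n = adjacency_matrix ` PiE_dflt (vertex_pairs n) False (\<lambda>_. UNIV)"

lemma finite_zero_one_matrices [simp]: "finite (zero_one_matrices n)"
  unfolding zero_one_matrices_def by (intro finite_imageI finite_PiE_dflt) auto

lemma set_independent_edges: "set_pmf (independent_edges n q) \<subseteq> zero_one_matrices n"
  using set_Pi_pmf_subset'[OF finite_vertex_pairs, of n False]
  unfolding independent_edges_def zero_one_matrices_def
  by (fastforce simp: PiE_dflt_def)

lemma finite_set_independent_edges [simp]: "finite (set_pmf (independent_edges n q))"
  using set_independent_edges finite_zero_one_matrices finite_subset by blast

lemma integrable_independent_edges [simp]:
  fixes f :: "matrix_real \<Rightarrow> real"
  shows "integrable (measure_pmf (independent_edges n q)) f"
  by (rule integrable_measure_pmf_finite) simp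

text \<open>Independence of the coordinates, by splitting off one coordinate at a time. As the value
  type is finite, every expectation here is a finite sum.\<close>

lemma expectation_prod_Pi_pmf_finite:
  fixes f :: "'a \<Rightarrow> 'b :: finite \<Rightarrow> real"
  assumes "finite A"
  shows "measure_pmf.expectation (Pi_pmf A dflt p) (\<lambda>y. \<Prod>x\<in>A. f x (y x)) =
    (\<Prod>x\<in>A. measure_pmf.expectation (p x) (f x))"
  using assms
proof (induction A rule: finite_induct)
  case empty
  then show ?case by simp
next
  case (insert x A)
  have fin: "finite (set_pmf (Pi_pmf A dflt p))"
    by (rule finite_subset[OF set_Pi_pmf_subset'[OF insert.hyps(1)]])
       (use insert.hyps in \<open>auto intro!: finite_PiE_dflt\<close>)
  have "Pi_pmf (insert x A) dflt p = p x \<bind> (\<lambda>y. map_pmf (\<lambda>g. g(x := y)) (Pi_pmf A dflt p))"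
    using insert.hyps by (simp add: Pi_pmf_insert' map_pmf_def)
  then have "measure_pmf.expectation (Pi_pmf (insert x A) dflt p) (\<lambda>y. \<Prod>x\<in>insert x A. f x (y x)) =
      (\<Sum>b\<in>UNIV. pmf (p x) b * measure_pmf.expectation (Pi_pmf A dflt p)
        (\<lambda>g. \<Prod>z\<in>insert x A. f z ((g(x := b)) z)))"
    using fin by (simp add: pmf_expectation_bind[of UNIV])
  also have "\<dots> = (\<Sum>b\<in>UNIV. pmf (p x) b * (f x b * measure_pmf.expectation (Pi_pmf A dflt p)
        (\<lambda>g. \<Prod>z\<in>A. f z (g z))))"
  proof (intro sum.cong refl arg_cong2[where f = "(*)"])
    fix b
    have "(\<Prod>z\<in>insert x A. f z ((g(x := b)) z)) = f x b * (\<Prod>z\<in>A. f z (g z))" for g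
      using insert.hyps by (auto intro!: prod.cong)
    then show "measure_pmf.expectation (Pi_pmf A dflt p) (\<lambda>g. \<Prod>z\<in>insert x A. f z ((g(x := b)) z)) =
        f x b * measure_pmf.expectation (Pi_pmf A dflt p) (\<lambda>g. \<Prod>z\<in>A. f z (g z))"
      by simp
  qed
  also have "\<dots> = measure_pmf.expectation (p x) (f x) * (\<Prod>z\<in>A. measure_pmf.expectation (p z) (f z))"
    by (subst integral_measure_pmf[of UNIV "p x"]) (auto simp: insert.IH sum_distrib_left mult_ac)
  finally show ?case using insert.hyps by simp
qed

text \<open>On increasing pairs an adjacency entry is the edge variable itself, and pairs outside
  \<open>S\<close> can be given the factor 1, so the product extends to all of
  \<open>vertex_pairs n\<close> and factorises. The range condition on \<open>q\<close> keeps
  \<open>bernoulli_pmf\<close> from truncating.\<close>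

lemma expectation_independent_edges_prod:
  assumes "S \<subseteq> vertex_pairs n" and "\<And>i j. (i, j) \<in> S \<Longrightarrow> q i j \<in> {0..1}"
  shows "measure_pmf.expectation (independent_edges n q) (\<lambda>x. \<Prod>e\<in>S. g e (x e)) =
    (\<Prod>(i, j)\<in>S. q i j * g (i, j) 1 + (1 - q i j) * g (i, j) (0::real) :: real)"
proof -
  let ?V = "vertex_pairs n"
  have adj: "adjacency_matrix e v = of_bool (e v)" if "v \<in> ?V" for e v
    using that by (auto simp: adjacency_matrix_def vertex_pairs_def)
  have "measure_pmf.expectation (independent_edges n q) (\<lambda>x. \<Prod>e\<in>S. g e (x e)) =
    measure_pmf.expectation (Pi_pmf ?V False (\<lambda>(i, j). bernoulli_pmf (q i j)))
      (\<lambda>e. \<Prod>v\<in>?V. if v \<in> S then g v (of_bool (e v)) else 1)"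
    unfolding independent_edges_def integral_map_pmf
  proof (rule arg_cong[where f = "measure_pmf.expectation _"], rule ext)
    fix e
    show "(\<Prod>v\<in>S. g v (adjacency_matrix e v)) = (\<Prod>v\<in>?V. if v \<in> S then g v (of_bool (e v)) else 1)"
      using assms(1) adj
      by (subst prod.inter_restrict[symmetric])
         (auto intro!: prod.cong simp: Int_absorb1)
  qed
  also have "\<dots> = (\<Prod>v\<in>?V. measure_pmf.expectation (case v of (i, j) \<Rightarrow> bernoulli_pmf (q i j))
      (\<lambda>b. if v \<in> S then g v (of_bool b) else 1))"
    by (rule expectation_prod_Pi_pmf_finite) simp
  also have "\<dots> = (\<Prod>v\<in>?V. if v \<in> S then (case v of (i, j) \<Rightarrow> q i j * g (i, j) 1 + (1 - q i j) * g (i, j) 0) else 1)"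
    using assms(2) by (intro prod.cong) (auto simp: mult_ac)
  also have "\<dots> = (\<Prod>(i, j)\<in>S. q i j * g (i, j) 1 + (1 - q i j) * g (i, j) 0)"
    using assms(1) by (subst prod.inter_restrict[symmetric]) (auto simp: Int_absorb1)
  finally show ?thesis .
qed

section \<open>An orthogonal basis for the Erdos-Renyi model\<close>

definition edge_character :: "real \<Rightarrow> (nat \<times> nat) set \<Rightarrow> matrix_real \<Rightarrow> real" where
  "edge_character p S x = (\<Prod>e\<in>S. x e - p)"

text \<open>Each centred edge variable has mean 0 and variance \<open>p * (1 - p)\<close>, so an
  edge in exactly one of \<open>S\<close> and \<open>T\<close> annihilates the product. These are
  the Fourier characters of the p-biased cube, left unnormalised.\<close>

lemma edge_character_orthogonal:
  assumes "S \<subseteq> vertex_pairs n" "T \<subseteq> vertex_pairs n" and p: "p \<in> {0..1}"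
  shows "measure_pmf.expectation (erdos_renyi n p)
      (\<lambda>x. edge_character p S x * edge_character p T x) =
    (if S = T then (p * (1 - p)) ^ card S else 0)"
proof -
  have fin: "finite S" "finite T"
    using assms finite_subset[OF _ finite_vertex_pairs] by blast+
  let ?g = "\<lambda>e y. (if e \<in> S then y - p else 1) * (if e \<in> T then y - p else 1)"
  have ext: "edge_character p A x = (\<Prod>e\<in>S \<union> T. if e \<in> A then x e - p else 1)"
    if "A \<subseteq> S \<union> T" for A x
    using that fin unfolding edge_character_def
    by (subst prod.inter_restrict[symmetric]) (auto simp: Int_absorb1)
  have "edge_character p S x * edge_character p T x = (\<Prod>e\<in>S \<union> T. ?g e (x e))" for x
    by (subst ext, simp, subst ext, simp, subst prod.distrib) simp
  then have "measure_pmf.expectation (erdos_renyi n p)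
      (\<lambda>x. edge_character p S x * edge_character p T x) =
      measure_pmf.expectation (independent_edges n (\<lambda>_ _. p)) (\<lambda>x. \<Prod>e\<in>S \<union> T. ?g e (x e))"
    by (simp add: erdos_renyi_def)
  also have "\<dots> = (\<Prod>e\<in>S \<union> T. p * ?g e 1 + (1 - p) * ?g e 0)"
    using assms by (subst expectation_independent_edges_prod) (auto intro!: prod.cong)
  also have "\<dots> = (if S = T then (p * (1 - p)) ^ card S else 0)"
  proof (cases "S = T")
    case True
    then have "(\<Prod>e\<in>S \<union> T. p * ?g e 1 + (1 - p) * ?g e 0) = (\<Prod>e\<in>S. p * (1 - p))"
      by (intro prod.cong) (auto simp: algebra_simps)
    with True show ?thesis by simp
  next
    case False
    then obtain e where "e \<in> S \<union> T" "\<not> (e \<in> S \<and> e \<in> T)" by blast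
    then have "\<exists>e\<in>S \<union> T. p * ?g e 1 + (1 - p) * ?g e 0 = 0"
      by (intro bexI[of _ e]) (auto simp: algebra_simps)
    then have "(\<Prod>e\<in>S \<union> T. p * ?g e 1 + (1 - p) * ?g e 0) = 0"
      using fin by (intro prod_zero) auto
    with False show ?thesis by simp
  qed
  finally show ?thesis .
qed

text \<open>The matrix \<open>k I - J\<close>, with \<open>J\<close> the all-ones matrix:
  \<open>k\<close> times the projection orthogonal to the constants. It is scaled so that an edge
  probability of the block model exceeds \<open>d / n\<close> by
  \<open>d / n * \<epsilon> / k\<close> times the kernel.\<close>

definition community_kernel :: "nat \<Rightarrow> nat \<Rightarrow> nat \<Rightarrow> real" where
  "community_kernel k a b = (if a = b then real k - 1 else - 1)"

definition labelling_mean :: "nat \<Rightarrow> nat \<Rightarrow> ((nat \<Rightarrow> nat) \<Rightarrow> real) \<Rightarrow> real" where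
  "labelling_mean n k f = (\<Sum>\<sigma>\<in>{..<n} \<rightarrow>\<^sub>E {..<k}. f \<sigma>) / real k ^ n"

definition subgraph_moment :: "nat \<Rightarrow> nat \<Rightarrow> (nat \<times> nat) set \<Rightarrow> real" where
  "subgraph_moment n k S = labelling_mean n k (\<lambda>\<sigma>. \<Prod>(i, j)\<in>S. community_kernel k (\<sigma> i) (\<sigma> j))"

text \<open>The squared norm of the likelihood ratio projected to degree at most \<open>l\<close>;
  \<open>\<rho>\<close> stands for the squared bias of one edge divided by its variance.\<close>

definition low_degree_norm_sq :: "nat \<Rightarrow> nat \<Rightarrow> real \<Rightarrow> nat \<Rightarrow> real" where
  "low_degree_norm_sq n k \<rho> l =
     (\<Sum>S | S \<subseteq> vertex_pairs n \<and> card S \<le> l. \<rho> ^ card S * (subgraph_moment n k S)\<^sup>2)"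

lemma labelling_mean_cmult: "labelling_mean n k (\<lambda>\<sigma>. c * f \<sigma>) = c * labelling_mean n k f"
  by (simp add: labelling_mean_def sum_distrib_left)

lemma subgraph_moment_empty [simp]: "k > 0 \<Longrightarrow> subgraph_moment n k {} = 1"
  by (simp add: subgraph_moment_def labelling_mean_def card_PiE)

lemma expectation_sbm:
  fixes f :: "matrix_real \<Rightarrow> real"
  assumes "k > 0"
  shows "measure_pmf.expectation (sbm n d \<epsilon> k) f =
    labelling_mean n k (\<lambda>\<sigma>. measure_pmf.expectation
      (independent_edges n (\<lambda>i j. sbm_edge_prob n d \<epsilon> k (\<sigma> i = \<sigma> j))) f)"
  unfolding sbm_def using assms
  by (subst pmf_expectation_bind_pmf_of_set)
     (auto simp: PiE_eq_empty_iff finite_PiE labelling_mean_def card_PiE sum_divide_distrib field_simps)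

lemma set_pmf_sbm: "k > 0 \<Longrightarrow> set_pmf (sbm n d \<epsilon> k) \<subseteq> zero_one_matrices n"
  unfolding sbm_def using set_independent_edges by fastforce

text \<open>Given the labels the edges are independent, and each centred edge has as mean its bias,
  a constant times the kernel.\<close>

lemma expectation_sbm_edge_character:
  assumes "S \<subseteq> vertex_pairs n" "k > 0" and "\<And>same. sbm_edge_prob n d \<epsilon> k same \<in> {0..1}"
  shows "measure_pmf.expectation (sbm n d \<epsilon> k) (edge_character (d / real n) S) =
    (d / real n * \<epsilon> / real k) ^ card S * subgraph_moment n k S"
proof -
  have "measure_pmf.expectation (independent_edges n (\<lambda>i j. sbm_edge_prob n d \<epsilon> k (\<sigma> i = \<sigma> j)))
      (edge_character (d / real n) S) =
      (d / real n * \<epsilon> / real k) ^ card S * (\<Prod>(i, j)\<in>S. community_kernel k (\<sigma> i) (\<sigma> j))" for \<sigma>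
  proof -
    have "measure_pmf.expectation (independent_edges n (\<lambda>i j. sbm_edge_prob n d \<epsilon> k (\<sigma> i = \<sigma> j)))
      (edge_character (d / real n) S) =
      (\<Prod>(i, j)\<in>S. sbm_edge_prob n d \<epsilon> k (\<sigma> i = \<sigma> j) * (1 - d / real n) +
         (1 - sbm_edge_prob n d \<epsilon> k (\<sigma> i = \<sigma> j)) * (0 - d / real n))"
      unfolding edge_character_def using assms
      by (subst expectation_independent_edges_prod[where g = "\<lambda>_ y. y - d / real n"]) auto
    also have "\<dots> = (\<Prod>(i, j)\<in>S. d / real n * \<epsilon> / real k * community_kernel k (\<sigma> i) (\<sigma> j))"
    proof (intro prod.cong refl, clarify)
      fix i j
      let ?q = "sbm_edge_prob n d \<epsilon> k (\<sigma> i = \<sigma> j)"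
      have "?q * (1 - d / real n) + (1 - ?q) * (0 - d / real n) = ?q - d / real n"
        by (simp add: algebra_simps)
      also have "\<dots> = d / real n * \<epsilon> / real k * community_kernel k (\<sigma> i) (\<sigma> j)"
        using \<open>k > 0\<close> by (cases "n = 0") (auto simp: sbm_edge_prob_def community_kernel_def field_simps)
      finally show "?q * (1 - d / real n) + (1 - ?q) * (0 - d / real n) =
        d / real n * \<epsilon> / real k * community_kernel k (\<sigma> i) (\<sigma> j)" .
    qed
    also have "\<dots> = (d / real n * \<epsilon> / real k) ^ card S * (\<Prod>(i, j)\<in>S. community_kernel k (\<sigma> i) (\<sigma> j))"
      by (simp only: case_prod_unfold prod.distrib prod_constant)
    finally show ?thesis .
  qed
  then show ?thesis
    by (simp add: expectation_sbm[OF \<open>k > 0\<close>] labelling_mean_cmult subgraph_moment_def)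
qed

section \<open>Polynomials as combinations of edge characters\<close>

lemma poly_eval_superset:
  assumes "finite K" "Poly_Mapping.keys p \<subseteq> K"
  shows "poly_eval p x =
    (\<Sum>m\<in>K. Poly_Mapping.lookup p m * (\<Prod>v\<in>Poly_Mapping.keys m. x v ^ Poly_Mapping.lookup m v))"
  unfolding poly_eval_def using assms
  by (intro sum.mono_neutral_left) (auto simp: in_keys_iff)

lemma poly_eval_add: "poly_eval (p + q) x = poly_eval p x + poly_eval q x"
proof -
  let ?K = "Poly_Mapping.keys p \<union> Poly_Mapping.keys q"
  have "Poly_Mapping.keys (p + q) \<subseteq> ?K" by (rule keys_add)
  then show ?thesis
    by (simp add: poly_eval_superset[of ?K] lookup_add distrib_right sum.distrib)
qed

lemma poly_eval_sum: "poly_eval (sum f I) x = (\<Sum>i\<in>I. poly_eval (f i) x)"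
  by (induction I rule: infinite_finite_induct) (auto simp: poly_eval_add, auto simp: poly_eval_def)

lemma polys_degree_le_add:
  "p \<in> polys_degree_le n l \<Longrightarrow> q \<in> polys_degree_le n l \<Longrightarrow> p + q \<in> polys_degree_le n l"
  using keys_add[of p q] unfolding polys_degree_le_def by blast

lemma polys_degree_le_sum:
  "(\<And>i. i \<in> I \<Longrightarrow> f i \<in> polys_degree_le n l) \<Longrightarrow> sum f I \<in> polys_degree_le n l"
  by (induction I rule: infinite_finite_induct) (auto simp: polys_degree_le_add, auto simp: polys_degree_le_def)

definition edge_monomial :: "(nat \<times> nat) set \<Rightarrow> real \<Rightarrow> matrix_poly" where
  "edge_monomial T c = Poly_Mapping.single (\<Sum>e\<in>T. Poly_Mapping.single e 1) c"

lemma lookup_sum_single: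
  "finite T \<Longrightarrow> Poly_Mapping.lookup (\<Sum>e\<in>T. Poly_Mapping.single e (1::nat)) v = of_bool (v \<in> T)"
  by (auto simp: lookup_sum lookup_single when_def sum.delta' of_bool_def)

lemma keys_sum_single:
  "finite T \<Longrightarrow> Poly_Mapping.keys (\<Sum>e\<in>T. Poly_Mapping.single e (1::nat)) = T"
  by (auto simp: in_keys_iff lookup_sum_single simp del: One_nat_def split: if_splits)

lemma poly_eval_edge_monomial: "finite T \<Longrightarrow> poly_eval (edge_monomial T c) x = c * (\<Prod>e\<in>T. x e)"
  by (subst poly_eval_superset[of "{\<Sum>e\<in>T. Poly_Mapping.single e 1}"])
     (auto simp: edge_monomial_def keys_sum_single lookup_sum_single simp del: One_nat_def)

lemma edge_monomial_degree:
  assumes "T \<subseteq> vertex_pairs n" "card T \<le> l"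
  shows "edge_monomial T c \<in> polys_degree_le n l"
proof -
  have "finite T" using assms(1) finite_subset finite_vertex_pairs by blast
  then show ?thesis
    using assms unfolding polys_degree_le_def edge_monomial_def
    by (auto simp: monomial_degree_def keys_sum_single lookup_sum_single vertex_pairs_def simp del: One_nat_def)
qed

text \<open>Expanding the product of the factors \<open>x e - p\<close> over the subsets of
  \<open>S\<close> yields squarefree monomials of degree at most \<open>card S\<close>.\<close>

lemma edge_characters_representable:
  assumes F: "F = {S. S \<subseteq> vertex_pairs n \<and> card S \<le> l}"
  shows "\<exists>P\<in>polys_degree_le n l. \<forall>x. poly_eval P x = (\<Sum>S\<in>F. c S * edge_character p S x)"
proof -
  let ?P = "\<Sum>S\<in>F. \<Sum>T\<in>Pow S. edge_monomial T (c S * (- p) ^ card (S - T))"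
  have fin: "finite S" if "S \<in> F" for S
    using that finite_subset[OF _ finite_vertex_pairs] by (auto simp: F)
  have "poly_eval ?P x = (\<Sum>S\<in>F. c S * edge_character p S x)" for x
  proof -
    have "(\<Sum>T\<in>Pow S. poly_eval (edge_monomial T (c S * (- p) ^ card (S - T))) x) =
        c S * edge_character p S x" if "S \<in> F" for S
    proof -
      have "edge_character p S x = (\<Sum>T\<in>Pow S. (\<Prod>e\<in>T. x e) * (- p) ^ card (S - T))"
        using prod_add[OF fin[OF that], of x "\<lambda>_. - p"] by (simp add: edge_character_def)
      then show ?thesis
        using finite_subset[OF _ fin[OF that]]
        by (auto simp: sum_distrib_left poly_eval_edge_monomial mult_ac intro!: sum.cong)
    qed
    then show ?thesis by (simp add: poly_eval_sum)
  qed
  moreover have "?P \<in> polys_degree_le n l"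
    using fin by (intro polys_degree_le_sum edge_monomial_degree)
      (auto simp: F dest: card_mono intro: order_trans[OF card_mono])
  ultimately show ?thesis by blast
qed

lemma monomial_on_zero_one_matrices:
  assumes "x \<in> zero_one_matrices n"
  shows "x (i, i) = 0" "i \<noteq> j \<Longrightarrow> x (i, j) = x (min i j, max i j)" "x v \<in> {0, 1}"
  using assms by (auto simp: zero_one_matrices_def adjacency_matrix_def PiE_dflt_def vertex_pairs_def
      split: prod.splits)

text \<open>On symmetric 0/1 matrices with zero diagonal, a monomial either vanishes or equals a
  squarefree product over a set \<open>T\<close> of increasing pairs, no larger than its degree.
  Writing each entry as \<open>(x e - p) + p\<close> expands that product into characters of subsets
  of \<open>T\<close>.\<close>

lemma poly_eval_edge_characters:
  assumes F: "F = {S. S \<subseteq> vertex_pairs n \<and> card S \<le> l}" and P: "P \<in> polys_degree_le n l"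
  shows "\<exists>c. \<forall>x\<in>zero_one_matrices n. poly_eval P x = (\<Sum>S\<in>F. c S * edge_character p S x)"
proof -
  have finF: "finite F" unfolding F by (rule finite_subset[of _ "Pow (vertex_pairs n)"]) auto
  let ?mon = "\<lambda>m x. \<Prod>v\<in>Poly_Mapping.keys m. x v ^ Poly_Mapping.lookup m v"
  have "\<exists>c. \<forall>x\<in>zero_one_matrices n. ?mon m x = (\<Sum>S\<in>F. c S * edge_character p S x)"
    if m: "m \<in> Poly_Mapping.keys P" for m
  proof (cases "\<exists>i. (i, i) \<in> Poly_Mapping.keys m")
    case True
    then obtain i where "(i, i) \<in> Poly_Mapping.keys m" by blast
    then have "?mon m x = 0" if "x \<in> zero_one_matrices n" for x
      using monomial_on_zero_one_matrices(1)[OF that]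
      by (intro prod_zero bexI[of _ "(i, i)"]) (auto simp: in_keys_iff)
    then show ?thesis by (intro exI[of _ "\<lambda>_. 0"]) auto
  next
    case False
    define s where "s = (\<lambda>(i::nat, j::nat). (min i j, max i j))"
    define T where "T = s ` Poly_Mapping.keys m"
    have finT: "finite T" by (simp add: T_def)
    have keys: "Poly_Mapping.keys m \<subseteq> {..<n} \<times> {..<n}" and deg: "monomial_degree m \<le> l"
      using P m unfolding polys_degree_le_def by blast+
    have T: "T \<subseteq> vertex_pairs n"
    proof
      fix e assume "e \<in> T"
      then obtain i j where "(i, j) \<in> Poly_Mapping.keys m" "e = (min i j, max i j)"
        by (auto simp: T_def s_def)
      moreover from this False have "i \<noteq> j" by auto
      ultimately show "e \<in> vertex_pairs n" using keys by (auto simp: vertex_pairs_def)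
    qed
    have "card T \<le> card (Poly_Mapping.keys m)" unfolding T_def by (rule card_image_le) simp
    also have "\<dots> \<le> monomial_degree m"
      unfolding monomial_degree_def card_eq_sum by (intro sum_mono) (auto simp: in_keys_iff)
    finally have cardT: "card T \<le> l" using deg by simp
    have sub: "Pow T \<subseteq> F"
      using T cardT card_mono[OF finT] by (auto simp: F intro: order_trans)
    have mon: "?mon m x = (\<Sum>S\<in>F. (if S \<subseteq> T then p ^ card (T - S) else 0) * edge_character p S x)"
      if x: "x \<in> zero_one_matrices n" for x
    proof -
      have sym: "x v = x (s v)" for v
        using monomial_on_zero_one_matrices(2)[OF x, of "fst v" "snd v"]
        by (cases v; cases "fst v = snd v") (auto simp: s_def)
      have "?mon m x = (\<Prod>v\<in>Poly_Mapping.keys m. x (s v))"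
      proof (intro prod.cong refl)
        fix v assume "v \<in> Poly_Mapping.keys m"
        then have "Poly_Mapping.lookup m v > 0" by (auto simp: in_keys_iff)
        then show "x v ^ Poly_Mapping.lookup m v = x (s v)"
          using monomial_on_zero_one_matrices(3)[OF x, of v] sym[of v] by (auto simp: power_0_left)
      qed
      \<comment> \<open>The map \<open>s\<close> may identify \<open>(i, j)\<close> with
        \<open>(j, i)\<close>, so this is no reindexing: the two products agree because all entries
        are 0 or 1.\<close>
      also have "\<dots> = (\<Prod>e\<in>T. x e)"
      proof (cases "\<exists>e\<in>T. x e = 0")
        case True
        then obtain v where v: "v \<in> Poly_Mapping.keys m" "x (s v) = 0" by (auto simp: T_def)
        have "(\<Prod>v\<in>Poly_Mapping.keys m. x (s v)) = 0" by (rule prod_zero) (use v in auto)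
        moreover have "(\<Prod>e\<in>T. x e) = 0" by (rule prod_zero) (use True finT in auto)
        ultimately show ?thesis by simp
      next
        case False
        then have "x e = 1" if "e \<in> T" for e
          using monomial_on_zero_one_matrices(3)[OF x, of e] that by auto
        then show ?thesis by (simp add: T_def)
      qed
      also have "\<dots> = (\<Sum>S\<in>Pow T. edge_character p S x * p ^ card (T - S))"
        using prod_add[OF finT, of "\<lambda>e. x e - p" "\<lambda>_. p"] by (simp add: edge_character_def)
      also have "\<dots> = (\<Sum>S\<in>F. (if S \<subseteq> T then p ^ card (T - S) else 0) * edge_character p S x)"
        using sub finF by (intro sum.mono_neutral_cong_left) auto
      finally show ?thesis .
    qed
    then show ?thesis
      by (intro exI[of _ "\<lambda>S. if S \<subseteq> T then p ^ card (T - S) else 0"]) blast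
  qed
  then obtain c where c: "\<And>m x. m \<in> Poly_Mapping.keys P \<Longrightarrow> x \<in> zero_one_matrices n \<Longrightarrow>
      ?mon m x = (\<Sum>S\<in>F. c m S * edge_character p S x)"
    by metis
  have "poly_eval P x = (\<Sum>S\<in>F. (\<Sum>m\<in>Poly_Mapping.keys P. Poly_Mapping.lookup P m * c m S) * edge_character p S x)"
    if "x \<in> zero_one_matrices n" for x
    unfolding poly_eval_def using c[OF _ that]
    by (simp add: sum_distrib_left sum_distrib_right sum.swap[of _ F] mult_ac)
  then show ?thesis by (intro exI[of _ "\<lambda>S. \<Sum>m\<in>Poly_Mapping.keys P. Poly_Mapping.lookup P m * c m S"]) blast
qed

section \<open>The maximum, by the Cauchy-Schwarz inequality\<close>

lemma expectation_cong_support: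
  "(\<And>x. x \<in> set_pmf M \<Longrightarrow> f x = g x) \<Longrightarrow> measure_pmf.expectation M f = measure_pmf.expectation M g"
  by (rule integral_cong_AE) (auto simp: AE_measure_pmf_iff)

text \<open>In the coefficients \<open>c\<close> with respect to the characters, the numerator is
  the linear form with weights \<open>\<mu>\<close> and the squared denominator the diagonal form
  with weights \<open>v\<close>. Cauchy-Schwarz bounds the ratio by \<open>sqrt N\<close>, and
  \<open>c = \<mu> / v\<close> attains this, so the greatest value in the definition exists.\<close>

lemma max_low_degree_ratio_eq:
  assumes d: "0 < d" "d < real n" and k: "k > 0"
    and prob: "\<And>same. sbm_edge_prob n d \<epsilon> k same \<in> {0..1}"
  shows "max_low_degree_ratio n d \<epsilon> k l =
    sqrt (low_degree_norm_sq n k (\<epsilon>\<^sup>2 * d / (real k)\<^sup>2 / (real n - d)) l)"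
proof -
  define p where "p = d / real n"
  define F where F: "F = {S. S \<subseteq> vertex_pairs n \<and> card S \<le> l}"
  define \<mu> where "\<mu> S = (p * \<epsilon> / real k) ^ card S * subgraph_moment n k S" for S
  define v where "v S = (p * (1 - p)) ^ card S" for S :: "(nat \<times> nat) set"
  have p: "0 < p" "p < 1" using d by (auto simp: p_def)
  have v: "v S > 0" for S using p by (simp add: v_def)
  have finF: "finite F" unfolding F by (rule finite_subset[of _ "Pow (vertex_pairs n)"]) auto
  \<comment> \<open>The empty edge set makes \<open>N\<close> positive, hence the denominator of the
    extremal polynomial nonzero.\<close>
  have "\<mu> {} = 1" using k by (simp add: \<mu>_def)
  moreover have "{} \<in> F" by (simp add: F)
  ultimately have pos: "(\<Sum>S\<in>F. (\<mu> S)\<^sup>2 / v S) > 0"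
    using finF v by (intro sum_pos2[of F "{}"]) (auto simp: less_imp_le)
  define N where "N = (\<Sum>S\<in>F. (\<mu> S)\<^sup>2 / v S)"
  have N_eq: "N = low_degree_norm_sq n k (\<epsilon>\<^sup>2 * d / (real k)\<^sup>2 / (real n - d)) l"
    unfolding N_def low_degree_norm_sq_def F[symmetric]
  proof (intro sum.cong refl)
    fix S :: "(nat \<times> nat) set"
    \<comment> \<open>One edge contributes its squared bias over its variance; with
      \<open>p = d / n\<close> a factor \<open>p\<close> cancels and \<open>1 - p\<close> produces
      \<open>n - d\<close>.\<close>
    have "(p * \<epsilon> / real k)\<^sup>2 / (p * (1 - p)) = \<epsilon>\<^sup>2 * d / (real k)\<^sup>2 / (real n - d)"
      using d k by (simp add: p_def field_simps power2_eq_square)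
    then have "((p * \<epsilon> / real k)\<^sup>2) ^ card S / (p * (1 - p)) ^ card S =
        (\<epsilon>\<^sup>2 * d / (real k)\<^sup>2 / (real n - d)) ^ card S"
      by (metis power_divide)
    moreover have "((p * \<epsilon> / real k) ^ card S)\<^sup>2 = ((p * \<epsilon> / real k)\<^sup>2) ^ card S"
      by (simp only: power_mult[symmetric] mult.commute)
    ultimately show "(\<mu> S)\<^sup>2 / v S = (\<epsilon>\<^sup>2 * d / (real k)\<^sup>2 / (real n - d)) ^ card S * (subgraph_moment n k S)\<^sup>2"
      unfolding \<mu>_def v_def power_mult_distrib[of _ "subgraph_moment n k S"]
      by (simp only: times_divide_eq_left[symmetric])
  qed
  have num: "measure_pmf.expectation (sbm n d \<epsilon> k) (poly_eval P) = (\<Sum>S\<in>F. c S * \<mu> S)"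
    if "\<forall>x\<in>zero_one_matrices n. poly_eval P x = (\<Sum>S\<in>F. c S * edge_character p S x)" for P c
  proof -
    have fin: "finite (set_pmf (sbm n d \<epsilon> k))"
      by (rule finite_subset[OF set_pmf_sbm[OF k]]) simp
    have "measure_pmf.expectation (sbm n d \<epsilon> k) (poly_eval P) =
        measure_pmf.expectation (sbm n d \<epsilon> k) (\<lambda>x. \<Sum>S\<in>F. c S * edge_character p S x)"
      by (rule expectation_cong_support) (use that set_pmf_sbm[OF k] in blast)
    also have "\<dots> = (\<Sum>S\<in>F. c S * measure_pmf.expectation (sbm n d \<epsilon> k) (edge_character p S))"
      using fin by (simp add: integrable_measure_pmf_finite)
    also have "\<dots> = (\<Sum>S\<in>F. c S * \<mu> S)"
      using expectation_sbm_edge_character[OF _ k prob]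
      by (intro sum.cong) (auto simp: F \<mu>_def p_def)
    finally show ?thesis .
  qed
  have den: "measure_pmf.expectation (erdos_renyi n (d / real n)) (\<lambda>x. (poly_eval P x)\<^sup>2) = (\<Sum>S\<in>F. (c S)\<^sup>2 * v S)"
    if "\<forall>x\<in>zero_one_matrices n. poly_eval P x = (\<Sum>S\<in>F. c S * edge_character p S x)" for P c
  proof -
    have "measure_pmf.expectation (erdos_renyi n p) (\<lambda>x. (poly_eval P x)\<^sup>2) =
        measure_pmf.expectation (erdos_renyi n p)
          (\<lambda>x. \<Sum>S\<in>F. \<Sum>T\<in>F. c S * c T * (edge_character p S x * edge_character p T x))"
    proof (rule expectation_cong_support)
      fix x assume "x \<in> set_pmf (erdos_renyi n p)"
      then have "x \<in> zero_one_matrices n"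
        using set_independent_edges unfolding erdos_renyi_def by blast
      then show "(poly_eval P x)\<^sup>2 =
          (\<Sum>S\<in>F. \<Sum>T\<in>F. c S * c T * (edge_character p S x * edge_character p T x))"
        using that by (simp add: power2_eq_square sum_product mult_ac)
    qed
    also have "\<dots> = (\<Sum>S\<in>F. \<Sum>T\<in>F. c S * c T *
        measure_pmf.expectation (erdos_renyi n p) (\<lambda>x. edge_character p S x * edge_character p T x))"
      by (simp add: erdos_renyi_def)
    also have "\<dots> = (\<Sum>S\<in>F. \<Sum>T\<in>F. if S = T then (c S)\<^sup>2 * v S else 0)"
      using p by (intro sum.cong refl)
        (auto simp: edge_character_orthogonal F v_def power2_eq_square)
    finally show ?thesis using finF by (simp add: p_def)
  qed
  have upper: "low_degree_ratio n d \<epsilon> k P \<le> sqrt N"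
    if P: "P \<in> polys_degree_le n l" for P
  proof -
    obtain c where c: "\<forall>x\<in>zero_one_matrices n. poly_eval P x = (\<Sum>S\<in>F. c S * edge_character p S x)"
      using poly_eval_edge_characters[OF F P] by blast
    have "(\<Sum>S\<in>F. c S * \<mu> S) = (\<Sum>S\<in>F. (c S * sqrt (v S)) * (\<mu> S / sqrt (v S)))"
      using v by (intro sum.cong) (auto simp: less_imp_neq[symmetric])
    also have "\<dots> \<le> sqrt (\<Sum>S\<in>F. (c S)\<^sup>2 * v S) * sqrt N"
    proof -
      have "(\<Sum>S\<in>F. (c S * sqrt (v S)) * (\<mu> S / sqrt (v S)))\<^sup>2 \<le>
        (\<Sum>S\<in>F. (c S * sqrt (v S))\<^sup>2) * (\<Sum>S\<in>F. (\<mu> S / sqrt (v S))\<^sup>2)"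
        by (rule Cauchy_Schwarz_ineq_sum)
      also have "\<dots> = (\<Sum>S\<in>F. (c S)\<^sup>2 * v S) * N"
        using v by (simp add: N_def power_mult_distrib power_divide less_imp_le)
      finally show ?thesis unfolding real_sqrt_mult[symmetric] by (rule real_le_rsqrt)
    qed
    finally have le: "(\<Sum>S\<in>F. c S * \<mu> S) \<le> sqrt (\<Sum>S\<in>F. (c S)\<^sup>2 * v S) * sqrt N" .
    have "(\<Sum>S\<in>F. (c S)\<^sup>2 * v S) \<ge> 0" using v by (intro sum_nonneg) (simp add: less_imp_le)
    \<comment> \<open>If the denominator vanishes, the quotient is 0 by the convention for division,
      and the bound still holds.\<close>
    with le show ?thesis
      unfolding low_degree_ratio_def num[OF c] den[OF c] using pos
      by (cases "(\<Sum>S\<in>F. (c S)\<^sup>2 * v S) = 0")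
         (auto simp: N_def divide_le_eq mult_ac less_imp_le)
  qed
  have "\<exists>P\<in>polys_degree_le n l.
      measure_pmf.expectation (erdos_renyi n (d / real n)) (\<lambda>x. (poly_eval P x)\<^sup>2) \<noteq> 0 \<and>
      sqrt N = low_degree_ratio n d \<epsilon> k P"
  proof -
    \<comment> \<open>The equality case of Cauchy-Schwarz: numerator and squared denominator both
      become \<open>N\<close>.\<close>
    obtain P where P: "P \<in> polys_degree_le n l"
      and c: "\<forall>x\<in>zero_one_matrices n. poly_eval P x = (\<Sum>S\<in>F. \<mu> S / v S * edge_character p S x)"
      using edge_characters_representable[OF F, of "\<lambda>S. \<mu> S / v S" p] by blast
    have "(\<Sum>S\<in>F. \<mu> S / v S * \<mu> S) = N" "(\<Sum>S\<in>F. (\<mu> S / v S)\<^sup>2 * v S) = N"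
      using v by (auto simp: N_def power2_eq_square less_imp_neq[symmetric] intro!: sum.cong)
    then have "measure_pmf.expectation (erdos_renyi n (d / real n)) (\<lambda>x. (poly_eval P x)\<^sup>2) = N"
      and "low_degree_ratio n d \<epsilon> k P = sqrt N"
      using pos by (simp_all add: low_degree_ratio_def num[OF c] den[OF c] real_div_sqrt N_def[symmetric])
    then show ?thesis using P pos N_def by (intro bexI[of _ P]) auto
  qed
  then have "max_low_degree_ratio n d \<epsilon> k l = sqrt N"
    unfolding max_low_degree_ratio_def using upper by (intro Greatest_equality) auto
  with N_eq show ?thesis by simp
qed

section \<open>Cycles\<close>

lemma sum_PiE_insert:
  fixes g :: "('a \<Rightarrow> 'b) \<Rightarrow> 'c :: comm_monoid_add"
  assumes "v \<notin> J"
  shows "(\<Sum>\<sigma>\<in>Pi\<^sub>E (insert v J) B. g \<sigma>) = (\<Sum>y\<in>B v. \<Sum>h\<in>Pi\<^sub>E J B. g (h(v := y)))"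
  unfolding PiE_insert_eq using inj_combinator[OF assms, of B]
  by (simp add: sum.reindex sum.cartesian_product case_prod_unfold)

text \<open>The label of \<open>v\<close> is uniform and independent of the others, so it may be
  redrawn. This is the way a single vertex is averaged out.\<close>

lemma labelling_mean_resample:
  assumes "v < n" "k > 0"
  shows "labelling_mean n k f = labelling_mean n k (\<lambda>\<sigma>. \<Sum>b<k. f (\<sigma>(v := b))) / real k"
proof -
  define J where "J = {..<n} - {v}"
  have J: "{..<n} = insert v J" "v \<notin> J" using assms by (auto simp: J_def)
  show ?thesis using assms(2)
    unfolding labelling_mean_def J(1) sum_PiE_insert[OF J(2)]
    by (simp add: sum.swap[of _ "{..<k}"])
qed

lemma labelling_mean_cong:
  "(\<And>\<sigma>. \<sigma> \<in> {..<n} \<rightarrow>\<^sub>E {..<k} \<Longrightarrow> f \<sigma> = g \<sigma>) \<Longrightarrow> labelling_mean n k f = labelling_mean n k g"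
  by (simp add: labelling_mean_def)

lemma labelling_mean_const: "k > 0 \<Longrightarrow> labelling_mean n k (\<lambda>_. c) = c"
  by (simp add: labelling_mean_def card_PiE)

lemma community_kernel_commute: "community_kernel k a b = community_kernel k b a"
  by (simp add: community_kernel_def)

text \<open>The identity \<open>M^2 = k M\<close> for \<open>M = k I - J\<close>, entry by
  entry.\<close>

lemma community_kernel_compose:
  assumes "a < k" "c < k"
  shows "(\<Sum>b<k. community_kernel k a b * community_kernel k b c) = real k * community_kernel k a c"
proof -
  have "community_kernel k a b * community_kernel k b c =
      (real k)\<^sup>2 * (if b = a then of_bool (a = c) else 0) - real k * (if b = a then 1 else 0)
      - real k * (if b = c then 1 else 0) + 1" for b
    by (auto simp: community_kernel_def algebra_simps power2_eq_square)
  then show ?thesis using assms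
    by (simp only: sum.distrib sum_subtractf sum_distrib_left[symmetric] sum.delta finite_lessThan)
       (simp add: community_kernel_def power2_eq_square algebra_simps)
qed

text \<open>Redrawing the label of an interior vertex merges its two edges into one: the factor
  \<open>k\<close> from \<open>community_kernel_compose\<close> cancels the \<open>1 / k\<close> of
  the average. The function \<open>h\<close> carries the rest of the graph and must ignore the
  interior labels.\<close>

lemma labelling_mean_path:
  assumes k: "k > 0" and j: "1 \<le> j" and z: "inj_on z {..j}" "z ` {..j} \<subseteq> {..<n}"
    and h: "\<And>\<sigma> i b. 1 \<le> i \<Longrightarrow> i < j \<Longrightarrow> h (\<sigma>(z i := b)) = h \<sigma>"
  shows "labelling_mean n k (\<lambda>\<sigma>. (\<Prod>i<j. community_kernel k (\<sigma> (z i)) (\<sigma> (z (Suc i)))) * h \<sigma>) =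
    labelling_mean n k (\<lambda>\<sigma>. community_kernel k (\<sigma> (z 0)) (\<sigma> (z j)) * h \<sigma>)"
  using j z h
proof (induction j arbitrary: h rule: nat_induct_at_least)
  case base
  then show ?case by simp
next
  case (Suc j)
  let ?K = "community_kernel k"
  have ne: "z i \<noteq> z i'" if "i \<noteq> i'" "i \<le> Suc j" "i' \<le> Suc j" for i i'
    using Suc.prems(1) that by (auto dest: inj_onD)
  have lt: "z i < n" if "i \<le> Suc j" for i using Suc.prems(2) that by (auto simp: image_subset_iff)
  have "labelling_mean n k (\<lambda>\<sigma>. (\<Prod>i<Suc j. ?K (\<sigma> (z i)) (\<sigma> (z (Suc i)))) * h \<sigma>) =
    labelling_mean n k (\<lambda>\<sigma>. (\<Prod>i<j. ?K (\<sigma> (z i)) (\<sigma> (z (Suc i)))) * (?K (\<sigma> (z j)) (\<sigma> (z (Suc j))) * h \<sigma>))"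
    by (simp add: mult_ac)
  \<comment> \<open>The last edge touches no interior vertex of the shorter path, so the induction
    hypothesis applies with this edge absorbed into \<open>h\<close>.\<close>
  also have "\<dots> = labelling_mean n k (\<lambda>\<sigma>. ?K (\<sigma> (z 0)) (\<sigma> (z j)) * (?K (\<sigma> (z j)) (\<sigma> (z (Suc j))) * h \<sigma>))"
  proof (rule Suc.IH)
    show "inj_on z {..j}" using Suc.prems(1) by (rule inj_on_subset) auto
    show "z ` {..j} \<subseteq> {..<n}" using Suc.prems(2) by (auto simp: image_subset_iff)
    show "?K ((\<sigma>(z i := b)) (z j)) ((\<sigma>(z i := b)) (z (Suc j))) * h (\<sigma>(z i := b)) =
        ?K (\<sigma> (z j)) (\<sigma> (z (Suc j))) * h \<sigma>" if "1 \<le> i" "i < j" for \<sigma> i b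
      using that ne[of j i] ne[of "Suc j" i] Suc.prems(3)[of i \<sigma> b]
      by (simp add: fun_upd_other del: fun_upd_apply)
  qed
  also have "\<dots> = labelling_mean n k (\<lambda>\<sigma>. \<Sum>b<k. ?K (\<sigma> (z 0)) b * ?K b (\<sigma> (z (Suc j))) * h \<sigma>) / real k"
  proof -
    have "h (\<sigma>(z j := b)) = h \<sigma>" for \<sigma> b using Suc.prems(3)[of j \<sigma> b] Suc.hyps by (simp del: fun_upd_apply)
    then show ?thesis
      using ne[of 0 j] ne[of "Suc j" j] Suc.hyps lt[of j] k
      by (subst labelling_mean_resample[of "z j"])
         (simp_all add: fun_upd_other fun_upd_same mult_ac del: fun_upd_apply)
  qed
  also have "\<dots> = labelling_mean n k (\<lambda>\<sigma>. real k * (?K (\<sigma> (z 0)) (\<sigma> (z (Suc j))) * h \<sigma>)) / real k"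
  proof (rule arg_cong[where f = "\<lambda>x. x / real k"], rule labelling_mean_cong)
    fix \<sigma> assume "\<sigma> \<in> {..<n} \<rightarrow>\<^sub>E {..<k}"
    then have "\<sigma> (z 0) < k" "\<sigma> (z (Suc j)) < k" using lt[of 0] lt[of "Suc j"] by auto
    then show "(\<Sum>b<k. ?K (\<sigma> (z 0)) b * ?K b (\<sigma> (z (Suc j))) * h \<sigma>) =
        real k * (?K (\<sigma> (z 0)) (\<sigma> (z (Suc j))) * h \<sigma>)"
      using community_kernel_compose by (simp add: sum_distrib_right[symmetric])
  qed
  finally show ?case using k by (simp add: labelling_mean_cmult)
qed

text \<open>Contracting the path from \<open>z 0\<close> to its last vertex leaves a double edge;
  averaging out one end leaves the diagonal value \<open>k - 1\<close> of the kernel.\<close>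

lemma labelling_mean_cycle:
  assumes k: "k > 0" and m: "m \<ge> 2" and z: "inj_on z {..<m}" "z ` {..<m} \<subseteq> {..<n}"
  shows "labelling_mean n k (\<lambda>\<sigma>. \<Prod>i<m. community_kernel k (\<sigma> (z i)) (\<sigma> (z (Suc i mod m)))) = real k - 1"
proof -
  let ?K = "community_kernel k"
  obtain j where j: "m = Suc j" "1 \<le> j" using m by (cases m) auto
  have ne: "z i \<noteq> z i'" if "i \<noteq> i'" "i \<le> j" "i' \<le> j" for i i'
    using z(1) that j by (auto dest: inj_onD)
  have lt: "z i < n" if "i \<le> j" for i using z(2) that j by (auto simp: image_subset_iff)
  have "labelling_mean n k (\<lambda>\<sigma>. \<Prod>i<m. ?K (\<sigma> (z i)) (\<sigma> (z (Suc i mod m)))) =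
    labelling_mean n k (\<lambda>\<sigma>. (\<Prod>i<j. ?K (\<sigma> (z i)) (\<sigma> (z (Suc i)))) * ?K (\<sigma> (z j)) (\<sigma> (z 0)))"
    by (simp add: j)
  also have "\<dots> = labelling_mean n k (\<lambda>\<sigma>. ?K (\<sigma> (z 0)) (\<sigma> (z j)) * ?K (\<sigma> (z j)) (\<sigma> (z 0)))"
  proof (rule labelling_mean_path[OF k j(2)])
    show "inj_on z {..j}" "z ` {..j} \<subseteq> {..<n}" using z j by (auto simp: lessThan_Suc_atMost)
    show "?K ((\<sigma>(z i := b)) (z j)) ((\<sigma>(z i := b)) (z 0)) = ?K (\<sigma> (z j)) (\<sigma> (z 0))"
      if "1 \<le> i" "i < j" for \<sigma> i b
      using that ne[of j i] ne[of 0 i] by auto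
  qed
  also have "\<dots> = labelling_mean n k (\<lambda>\<sigma>. \<Sum>b<k. ?K (\<sigma> (z 0)) b * ?K b (\<sigma> (z 0))) / real k"
    using ne[of j 0] j lt[of j] k by (subst labelling_mean_resample[of "z j"]) auto
  also have "\<dots> = labelling_mean n k (\<lambda>\<sigma>. real k * (real k - 1)) / real k"
  proof (rule arg_cong[where f = "\<lambda>x. x / real k"], rule labelling_mean_cong)
    fix \<sigma> assume "\<sigma> \<in> {..<n} \<rightarrow>\<^sub>E {..<k}"
    then have "\<sigma> (z 0) < k" using lt[of 0] by auto
    then show "(\<Sum>b<k. ?K (\<sigma> (z 0)) b * ?K b (\<sigma> (z 0))) = real k * (real k - 1)"
      by (simp add: community_kernel_compose) (simp add: community_kernel_def)
  qed
  finally show ?thesis using k by (simp add: labelling_mean_const)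
qed

section \<open>Edge sets of cycles and their number\<close>

definition unordered_edge :: "nat \<Rightarrow> nat \<Rightarrow> nat \<times> nat" where
  "unordered_edge i j = (min i j, max i j)"

lemma unordered_edge_eq_iff:
  "unordered_edge a b = unordered_edge c d \<longleftrightarrow> a = c \<and> b = d \<or> a = d \<and> b = c"
  by (auto simp: unordered_edge_def min_def max_def split: if_splits)

definition cycle_edges :: "nat \<Rightarrow> (nat \<Rightarrow> nat) \<Rightarrow> (nat \<times> nat) set" where
  "cycle_edges m z = (\<lambda>i. unordered_edge (z i) (z (Suc i mod m))) ` {..<m}"

lemma Suc_mod_eq: "i < m \<Longrightarrow> Suc i mod m = (if Suc i = m then 0 else Suc i)"
  by auto

text \<open>Coinciding edges with different indices would have swapped endpoints, forcing two steps
  along the cycle to return to the start. This is excluded for length at least 3, whereas for length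
  2 both edges do coincide.\<close>

lemma inj_on_cycle_edges:
  assumes m: "m \<ge> 3" and z: "inj_on z {..<m}"
  shows "inj_on (\<lambda>i. unordered_edge (z i) (z (Suc i mod m))) {..<m}"
proof (rule inj_onI)
  fix i j assume ij: "i \<in> {..<m}" "j \<in> {..<m}"
    and eq: "unordered_edge (z i) (z (Suc i mod m)) = unordered_edge (z j) (z (Suc j mod m))"
  have inj: "z a = z b \<longleftrightarrow> a = b" if "a < m" "b < m" for a b
    using z that by (auto dest: inj_onD)
  show "i = j"
    using eq ij m unfolding unordered_edge_eq_iff
    by (auto simp: inj Suc_mod_eq split: if_splits)
qed

lemma cycle_edges_subset:
  assumes "m \<ge> 2" "inj_on z {..<m}" "z ` {..<m} \<subseteq> {..<n}"
  shows "cycle_edges m z \<subseteq> vertex_pairs n"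
proof -
  have "unordered_edge (z i) (z (Suc i mod m)) \<in> vertex_pairs n" if "i < m" for i
  proof -
    have "Suc i mod m < m" "Suc i mod m \<noteq> i" using assms(1) that by (auto simp: Suc_mod_eq)
    then have "z i \<noteq> z (Suc i mod m)" "z i < n" "z (Suc i mod m) < n"
      using assms(2,3) that by (auto dest: inj_onD simp: image_subset_iff)
    then show ?thesis by (auto simp: unordered_edge_def vertex_pairs_def)
  qed
  then show ?thesis by (auto simp: cycle_edges_def)
qed

lemma subgraph_moment_cycle:
  assumes k: "k > 0" and m: "m \<ge> 3" and z: "inj_on z {..<m}" "z ` {..<m} \<subseteq> {..<n}"
  shows "subgraph_moment n k (cycle_edges m z) = real k - 1"
proof -
  let ?K = "community_kernel k"
  have "(\<Prod>(i, j)\<in>cycle_edges m z. ?K (\<sigma> i) (\<sigma> j)) =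
      (\<Prod>i<m. ?K (\<sigma> (z i)) (\<sigma> (z (Suc i mod m))))" for \<sigma>
    unfolding cycle_edges_def prod.reindex[OF inj_on_cycle_edges[OF m z(1)]]
    by (intro prod.cong)
       (auto simp: unordered_edge_def min_def max_def community_kernel_commute)
  then show ?thesis
    unfolding subgraph_moment_def using labelling_mean_cycle[OF k _ z] m by simp
qed

text \<open>The first two vertices fix the starting point and the orientation. After that, every
  vertex has only two neighbours on the cycle, one of which is its predecessor, so the successor is
  forced.\<close>

lemma cycle_edges_determine_vertices:
  assumes m: "m \<ge> 3" and z: "inj_on z {..<m}" and y: "inj_on y {..<m}"
    and eq: "cycle_edges m z = cycle_edges m y" and base: "z 0 = y 0" "z 1 = y 1"
    and i: "i < m"
  shows "z i = y i"
  using i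
proof (induction i rule: less_induct)
  case (less i)
  show ?case
  proof (cases "i \<le> 1")
    case True
    then have "i = 0 \<or> i = 1" by auto
    then show ?thesis using base by auto
  next
    case False
    then obtain j where j: "i = Suc (Suc j)" using that[of "i - 2"] by simp
    have zy: "z j = y j" "z (Suc j) = y (Suc j)" using less j by auto
    have "unordered_edge (y (Suc j)) (y i) \<in> cycle_edges m y"
      unfolding cycle_edges_def using less.prems j by (intro image_eqI[of _ _ "Suc j"]) auto
    then obtain h where h: "h < m"
      "unordered_edge (y (Suc j)) (y i) = unordered_edge (z h) (z (Suc h mod m))"
      unfolding eq[symmetric] by (auto simp: cycle_edges_def)
    have injz: "z a = z b \<longleftrightarrow> a = b" if "a < m" "b < m" for a b using z that by (auto dest: inj_onD)
    have injy: "y a = y b \<longleftrightarrow> a = b" if "a < m" "b < m" for a b using y that by (auto dest: inj_onD)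
    have Sm: "Suc h mod m < m" using h by (simp add: Suc_mod_eq)
    from h(2) consider "z (Suc j) = z h" "y i = z (Suc h mod m)"
      | "z (Suc j) = z (Suc h mod m)" "y i = z h"
      unfolding unordered_edge_eq_iff zy by auto
    then show ?thesis
    proof cases
      case 1
      then have "h = Suc j" using injz[of "Suc j" h] less.prems j h by auto
      then show ?thesis using 1 less.prems j by auto
    next
      \<comment> \<open>Here the edge is the one entering \<open>z (Suc j)\<close>, so that
        \<open>y i\<close> would repeat \<open>y j\<close>.\<close>
      case 2
      then have "Suc j = Suc h mod m" using injz[OF _ Sm, of "Suc j"] less.prems j by auto
      then have "h = j" using h(1) by (auto simp: Suc_mod_eq split: if_splits)
      then have "y i = y j" using 2 zy by simp
      then show ?thesis using injy[of i j] less.prems j by auto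
    qed
  qed
qed

text \<open>Only cycles of length \<open>m\<close> that begin with the vertices 0 and 1 are kept.
  They are coded injectively by the list of the remaining \<open>m - 2\<close> vertices, and each
  contributes \<open>\<rho> ^ m * (k - 1)^2\<close>, which is at least \<open>\<rho> ^ m\<close> as
  \<open>k \<ge> 2\<close>.\<close>

lemma low_degree_norm_sq_ge:
  assumes k: "k \<ge> 2" and m: "3 \<le> m" "m \<le> l" "m \<le> n" and \<rho>: "\<rho> \<ge> 0"
  shows "low_degree_norm_sq n k \<rho> l \<ge> real (n - m) ^ (m - 2) * \<rho> ^ m"
proof -
  define L where "L = {ys. length ys = m - 2 \<and> distinct ys \<and> set ys \<subseteq> {2..<n}}"
  define z where "z ys = (!) (0 # 1 # ys)" for ys :: "nat list"
  let ?F = "{S. S \<subseteq> vertex_pairs n \<and> card S \<le> l}"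
  have finF: "finite ?F" by (rule finite_subset[of _ "Pow (vertex_pairs n)"]) auto
  have z: "inj_on (z ys) {..<m}" "z ys ` {..<m} \<subseteq> {..<n}" if "ys \<in> L" for ys
  proof -
    have len: "length (0 # 1 # ys) = m" and dist: "distinct (0 # 1 # ys)"
      and sub: "set (0 # 1 # ys) \<subseteq> {..<n}"
      using that m by (auto simp: L_def)
    show "inj_on (z ys) {..<m}"
      unfolding z_def using dist len by (intro inj_on_nth) simp_all
    show "z ys ` {..<m} \<subseteq> {..<n}"
    proof (rule image_subsetI)
      fix i assume "i \<in> {..<m}"
      then have "(0 # 1 # ys) ! i \<in> set (0 # 1 # ys)" using len by (intro nth_mem) simp
      then show "z ys i \<in> {..<n}" using sub unfolding z_def by (rule subsetD[rotated])
    qed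
  qed
  have inj: "inj_on (\<lambda>ys. cycle_edges m (z ys)) L"
  proof (rule inj_onI)
    fix ys ys' assume L: "ys \<in> L" "ys' \<in> L" and eq: "cycle_edges m (z ys) = cycle_edges m (z ys')"
    have "0 # 1 # ys = 0 # 1 # ys'"
    proof (rule nth_equalityI)
      fix i assume "i < length (0 # 1 # ys)"
      then have "i < m" using L m by (auto simp: L_def)
      with cycle_edges_determine_vertices[OF m(1) z(1)[OF L(1)] z(1)[OF L(2)] eq]
      show "(0 # 1 # ys) ! i = (0 # 1 # ys') ! i" by (simp add: z_def)
    qed (use L in \<open>auto simp: L_def\<close>)
    then show "ys = ys'" by simp
  qed
  have card: "card (cycle_edges m (z ys)) = m" if "ys \<in> L" for ys
    unfolding cycle_edges_def by (simp add: card_image[OF inj_on_cycle_edges[OF m(1) z(1)[OF that]]])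
  have sub: "(\<lambda>ys. cycle_edges m (z ys)) ` L \<subseteq> ?F"
    using cycle_edges_subset[OF _ z] card m by (auto simp: subset_iff)
  \<comment> \<open>The lists are counted by the falling factorial from \<open>n - 2\<close> down to
    \<open>n - m + 1\<close>; its \<open>m - 2\<close> factors all exceed
    \<open>n - m\<close>.\<close>
  have "(n - m) ^ (m - 2) = (\<Prod>i\<in>{n - m + 1..n - 2}. n - m)"
  proof -
    have "Suc (n - 2) - (n - m + 1) = m - 2" using m by auto
    then show ?thesis by (simp only: prod_constant card_atLeastAtMost)
  qed
  also have "\<dots> \<le> \<Prod>{n - m + 1..n - 2}" by (intro prod_mono) auto
  also have "\<dots> = card L"
  proof -
    have "card {2..<n} - (m - 2) = n - m" "card {2..<n} = n - 2" "m - 2 \<le> n - 2" using m by auto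
    then show ?thesis
      unfolding L_def by (subst card_lists_distinct_length_eq) simp_all
  qed
  finally have "real ((n - m) ^ (m - 2)) \<le> real (card L)" by (simp only: of_nat_le_iff)
  then have "real (n - m) ^ (m - 2) * \<rho> ^ m \<le> real (card L) * \<rho> ^ m"
    using \<rho> by (intro mult_right_mono) simp_all
  also have "\<dots> = (\<Sum>ys\<in>L. \<rho> ^ m)" by simp
  also have "\<dots> \<le> (\<Sum>ys\<in>L. \<rho> ^ card (cycle_edges m (z ys)) * (subgraph_moment n k (cycle_edges m (z ys)))\<^sup>2)"
  proof (rule sum_mono)
    fix ys assume L: "ys \<in> L"
    have "\<rho> ^ m * 1 \<le> \<rho> ^ m * (real k - 1)\<^sup>2"
      using k \<rho> by (intro mult_left_mono one_le_power) simp_all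
    then show "\<rho> ^ m \<le> \<rho> ^ card (cycle_edges m (z ys)) * (subgraph_moment n k (cycle_edges m (z ys)))\<^sup>2"
      using subgraph_moment_cycle[OF _ m(1) z[OF L], of k] card[OF L] k by simp
  qed
  also have "\<dots> = (\<Sum>S\<in>(\<lambda>ys. cycle_edges m (z ys)) ` L. \<rho> ^ card S * (subgraph_moment n k S)\<^sup>2)"
    by (simp add: sum.reindex[OF inj])
  also have "\<dots> \<le> low_degree_norm_sq n k \<rho> l"
    unfolding low_degree_norm_sq_def using sub finF \<rho> by (intro sum_mono2) auto
  finally show ?thesis .
qed

section \<open>Moments of the overlap form\<close>

lemma labelling_mean_add: "labelling_mean n k (\<lambda>\<sigma>. f \<sigma> + g \<sigma>) = labelling_mean n k f + labelling_mean n k g"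
  by (simp add: labelling_mean_def sum.distrib add_divide_distrib)

lemma labelling_mean_sum: "labelling_mean n k (\<lambda>\<sigma>. \<Sum>i\<in>I. f i \<sigma>) = (\<Sum>i\<in>I. labelling_mean n k (f i))"
  by (simp add: labelling_mean_def sum.swap[of _ I] sum_divide_distrib)

lemma labelling_mean_mono:
  "(\<And>\<sigma>. \<sigma> \<in> {..<n} \<rightarrow>\<^sub>E {..<k} \<Longrightarrow> f \<sigma> \<le> g \<sigma>) \<Longrightarrow> labelling_mean n k f \<le> labelling_mean n k g"
  by (simp add: labelling_mean_def divide_right_mono sum_mono)

definition pair_mean :: "nat \<Rightarrow> nat \<Rightarrow> ((nat \<Rightarrow> nat) \<Rightarrow> (nat \<Rightarrow> nat) \<Rightarrow> real) \<Rightarrow> real" where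
  "pair_mean n k f = labelling_mean n k (\<lambda>\<sigma>. labelling_mean n k (f \<sigma>))"

lemma pair_mean_cmult: "pair_mean n k (\<lambda>\<sigma> \<tau>. c * f \<sigma> \<tau>) = c * pair_mean n k f"
  by (simp add: pair_mean_def labelling_mean_cmult)

lemma pair_mean_add: "pair_mean n k (\<lambda>\<sigma> \<tau>. f \<sigma> \<tau> + g \<sigma> \<tau>) = pair_mean n k f + pair_mean n k g"
  by (simp add: pair_mean_def labelling_mean_add)

lemma pair_mean_sum: "pair_mean n k (\<lambda>\<sigma> \<tau>. \<Sum>i\<in>I. f i \<sigma> \<tau>) = (\<Sum>i\<in>I. pair_mean n k (f i))"
  by (simp add: pair_mean_def labelling_mean_sum)

lemma pair_mean_mono:
  assumes "\<And>\<sigma> \<tau>. \<sigma> \<in> {..<n} \<rightarrow>\<^sub>E {..<k} \<Longrightarrow> \<tau> \<in> {..<n} \<rightarrow>\<^sub>E {..<k} \<Longrightarrow> f \<sigma> \<tau> \<le> g \<sigma> \<tau>"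
  shows "pair_mean n k f \<le> pair_mean n k g"
  unfolding pair_mean_def using assms by (intro labelling_mean_mono)

text \<open>The second, independent labelling turns a squared moment into one mean of a
  product.\<close>

lemma pair_mean_square: "pair_mean n k (\<lambda>\<sigma> \<tau>. f \<sigma> * f \<tau>) = (labelling_mean n k f)\<^sup>2"
proof -
  have "pair_mean n k (\<lambda>\<sigma> \<tau>. f \<sigma> * f \<tau>) = labelling_mean n k (\<lambda>\<sigma>. labelling_mean n k f * f \<sigma>)"
    by (simp add: pair_mean_def labelling_mean_cmult mult.commute)
  then show ?thesis by (simp add: labelling_mean_cmult power2_eq_square)
qed

text \<open>Expansion into ordered words, in which repetitions remain separate terms.\<close>

lemma sum_power_lists:
  fixes f :: "'a \<Rightarrow> 'b :: comm_semiring_1"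
  shows "(\<Sum>v\<in>V. f v) ^ t = (\<Sum>xs | set xs \<subseteq> V \<and> length xs = t. prod_list (map f xs))"
proof (induction t)
  case 0
  have "{xs. set xs \<subseteq> V \<and> length xs = 0} = {[]}" by auto
  then show ?case by simp
next
  case (Suc t)
  have inj: "inj_on (\<lambda>(xs, v). v # xs) ({xs. set xs \<subseteq> V \<and> length xs = t} \<times> V)"
    by (auto simp: inj_on_def)
  have "(\<Sum>v\<in>V. f v) ^ Suc t =
      (\<Sum>xs | set xs \<subseteq> V \<and> length xs = t. \<Sum>v\<in>V. f v * prod_list (map f xs))"
    by (simp add: Suc.IH sum_product) (rule sum.swap)
  also have "\<dots> = (\<Sum>(xs, v)\<in>{xs. set xs \<subseteq> V \<and> length xs = t} \<times> V. f v * prod_list (map f xs))"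
    by (rule sum.cartesian_product)
  finally show ?case
    unfolding lists_length_Suc_eq sum.reindex[OF inj] by (simp add: case_prod_unfold)
qed

section \<open>Sums of squared subgraph moments as moments of a quadratic form\<close>

definition pair_kernel :: "nat \<Rightarrow> (nat \<Rightarrow> nat) \<Rightarrow> (nat \<Rightarrow> nat) \<Rightarrow> nat \<times> nat \<Rightarrow> real" where
  "pair_kernel k \<sigma> \<tau> = (\<lambda>(i, j). community_kernel k (\<sigma> i) (\<sigma> j) * community_kernel k (\<tau> i) (\<tau> j))"

lemma pair_mean_prod_list_kernel:
  "pair_mean n k (\<lambda>\<sigma> \<tau>. prod_list (map (pair_kernel k \<sigma> \<tau>) xs)) =
    (labelling_mean n k (\<lambda>\<sigma>. prod_list (map (\<lambda>(i, j). community_kernel k (\<sigma> i) (\<sigma> j)) xs)))\<^sup>2"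
proof -
  have "prod_list (map (pair_kernel k \<sigma> \<tau>) xs) =
      prod_list (map (\<lambda>(i, j). community_kernel k (\<sigma> i) (\<sigma> j)) xs) *
      prod_list (map (\<lambda>(i, j). community_kernel k (\<tau> i) (\<tau> j)) xs)" for \<sigma> \<tau>
    by (induction xs) (auto simp: pair_kernel_def)
  then show ?thesis by (simp add: pair_mean_square)
qed

text \<open>Every word in the expansion of the power has a square as its mean. Odd moments are
  therefore nonnegative too, although the sum itself may be negative for some labellings.\<close>

lemma pair_mean_power_kernel_nonneg:
  "pair_mean n k (\<lambda>\<sigma> \<tau>. (\<Sum>e\<in>V. pair_kernel k \<sigma> \<tau> e) ^ t) \<ge> 0"
  unfolding sum_power_lists pair_mean_sum pair_mean_prod_list_kernel by (intro sum_nonneg) simp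

text \<open>
  Every ordered list of edges contributes a square, so lists with repeated edges may be added
  to the sum over edge sets.
\<close>
lemma sum_subgraph_moment_le_power:
  assumes V: "finite V"
  shows "fact t * (\<Sum>S | S \<subseteq> V \<and> card S = t. (subgraph_moment n k S)\<^sup>2) \<le>
    pair_mean n k (\<lambda>\<sigma> \<tau>. (\<Sum>e\<in>V. pair_kernel k \<sigma> \<tau> e) ^ t)"
proof -
  let ?A = "{S. S \<subseteq> V \<and> card S = t}"
  let ?q = "\<lambda>xs. (labelling_mean n k (\<lambda>\<sigma>. prod_list (map (\<lambda>(i, j). community_kernel k (\<sigma> i) (\<sigma> j)) xs)))\<^sup>2"
  have finA: "finite ?A" by (rule finite_subset[of _ "Pow V"]) (use V in auto)
  have fin: "finite S" if "S \<in> ?A" for S using that by (auto intro: finite_subset[OF _ V])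
  \<comment> \<open>Each set of \<open>t\<close> edges is enumerated by \<open>fact t\<close> lists,
    all with the same mean.\<close>
  have "fact t * (\<Sum>S\<in>?A. (subgraph_moment n k S)\<^sup>2) = (\<Sum>S\<in>?A. \<Sum>xs\<in>permutations_of_set S. ?q xs)"
    unfolding sum_distrib_left
  proof (intro sum.cong refl)
    fix S assume S: "S \<in> ?A"
    have "?q xs = (subgraph_moment n k S)\<^sup>2" if "xs \<in> permutations_of_set S" for xs
      using that by (auto simp: permutations_of_set_def subgraph_moment_def prod.distinct_set_conv_list)
    then show "fact t * (subgraph_moment n k S)\<^sup>2 = (\<Sum>xs\<in>permutations_of_set S. ?q xs)"
      using S fin[OF S] by simp
  qed
  also have "\<dots> = (\<Sum>xs\<in>(\<Union>S\<in>?A. permutations_of_set S). ?q xs)"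
  proof (rule sum.UNION_disjoint[symmetric])
    show "\<forall>S\<in>?A. finite (permutations_of_set S)" by simp
    show "\<forall>S\<in>?A. \<forall>T\<in>?A. S \<noteq> T \<longrightarrow> permutations_of_set S \<inter> permutations_of_set T = {}"
      unfolding permutations_of_set_def by blast
  qed (rule finA)
  also have "\<dots> \<le> (\<Sum>xs | set xs \<subseteq> V \<and> length xs = t. ?q xs)"
  proof (rule sum_mono2)
    show "finite {xs. set xs \<subseteq> V \<and> length xs = t}" using V by (rule finite_lists_length_eq)
    show "(\<Union>S\<in>?A. permutations_of_set S) \<subseteq> {xs. set xs \<subseteq> V \<and> length xs = t}"
      by (auto simp: permutations_of_set_def distinct_card)
  qed simp
  finally show ?thesis
    by (simp add: sum_power_lists pair_mean_sum pair_mean_prod_list_kernel)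
qed

lemma sum_all_pairs_kernel:
  "(\<Sum>i<n. \<Sum>j<n. pair_kernel k \<sigma> \<tau> (i, j)) =
    2 * (\<Sum>e\<in>vertex_pairs n. pair_kernel k \<sigma> \<tau> e) + real n * (real k - 1)\<^sup>2"
proof (induction n)
  case 0
  then show ?case by (simp add: vertex_pairs_def)
next
  case (Suc n)
  have "vertex_pairs (Suc n) = vertex_pairs n \<union> (\<lambda>i. (i, n)) ` {..<n}"
    by (auto simp: vertex_pairs_def)
  moreover have "vertex_pairs n \<inter> (\<lambda>i. (i, n)) ` {..<n} = {}"
    by (auto simp: vertex_pairs_def)
  moreover have "inj_on (\<lambda>i. (i, n)) {..<n}" by (auto simp: inj_on_def)
  ultimately have V: "(\<Sum>e\<in>vertex_pairs (Suc n). pair_kernel k \<sigma> \<tau> e) =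
      (\<Sum>e\<in>vertex_pairs n. pair_kernel k \<sigma> \<tau> e) + (\<Sum>i<n. pair_kernel k \<sigma> \<tau> (i, n))"
    by (simp add: sum.union_disjoint sum.reindex)
  have "(\<Sum>i<n. pair_kernel k \<sigma> \<tau> (n, i)) = (\<Sum>i<n. pair_kernel k \<sigma> \<tau> (i, n))"
    by (simp add: pair_kernel_def community_kernel_commute)
  moreover have "pair_kernel k \<sigma> \<tau> (n, n) = (real k - 1)\<^sup>2"
    by (simp add: pair_kernel_def community_kernel_def power2_eq_square)
  ultimately show ?case
    using Suc.IH by (simp add: V sum.distrib algebra_simps)
qed

text \<open>Half the full form is the sum over unordered pairs plus a constant
  \<open>c \<ge> 0\<close> from the diagonal. Adding \<open>c\<close> need not increase the power
  pointwise, but it increases the mean: in the binomial expansion all moments are nonnegative, and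
  the term \<open>s = t\<close> is the original one.\<close>

lemma sum_subgraph_moment_le_quadratic_form:
  "fact t * (\<Sum>S | S \<subseteq> vertex_pairs n \<and> card S = t. (subgraph_moment n k S)\<^sup>2) \<le>
    pair_mean n k (\<lambda>\<sigma> \<tau>. (\<Sum>i<n. \<Sum>j<n. pair_kernel k \<sigma> \<tau> (i, j)) ^ t) / 2 ^ t"
proof -
  define c where "c = real n * (real k - 1)\<^sup>2 / 2"
  let ?X = "\<lambda>\<sigma> \<tau>. \<Sum>e\<in>vertex_pairs n. pair_kernel k \<sigma> \<tau> e"
  have c: "c \<ge> 0" by (simp add: c_def)
  have half: "(\<Sum>i<n. \<Sum>j<n. pair_kernel k \<sigma> \<tau> (i, j)) = 2 * (?X \<sigma> \<tau> + c)" for \<sigma> \<tau>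
    by (simp add: sum_all_pairs_kernel c_def)
  have "fact t * (\<Sum>S | S \<subseteq> vertex_pairs n \<and> card S = t. (subgraph_moment n k S)\<^sup>2) \<le>
      pair_mean n k (\<lambda>\<sigma> \<tau>. ?X \<sigma> \<tau> ^ t)"
    by (rule sum_subgraph_moment_le_power) simp
  also have "\<dots> = (\<Sum>s\<in>{t}. (real (t choose s) * c ^ (t - s)) * pair_mean n k (\<lambda>\<sigma> \<tau>. ?X \<sigma> \<tau> ^ s))"
    by simp
  also have "\<dots> \<le> (\<Sum>s\<le>t. (real (t choose s) * c ^ (t - s)) * pair_mean n k (\<lambda>\<sigma> \<tau>. ?X \<sigma> \<tau> ^ s))"
    using c pair_mean_power_kernel_nonneg by (intro sum_mono2) (auto intro!: mult_nonneg_nonneg)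
  also have "\<dots> = pair_mean n k (\<lambda>\<sigma> \<tau>. (?X \<sigma> \<tau> + c) ^ t)"
  proof -
    have "(x + c) ^ t = (\<Sum>s\<le>t. (real (t choose s) * c ^ (t - s)) * x ^ s)" for x
      by (simp add: binomial_ring mult_ac)
    then show ?thesis by (simp only: pair_mean_sum pair_mean_cmult)
  qed
  also have "\<dots> = pair_mean n k (\<lambda>\<sigma> \<tau>. (\<Sum>i<n. \<Sum>j<n. pair_kernel k \<sigma> \<tau> (i, j)) ^ t) / 2 ^ t"
    unfolding half power_mult_distrib pair_mean_cmult by simp
  finally show ?thesis .
qed

section \<open>The quadratic form as a squared norm\<close>

definition centered_indicator :: "nat \<Rightarrow> nat \<Rightarrow> nat \<Rightarrow> real" where
  "centered_indicator k a s = of_bool (s = a) - 1 / real k"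

lemma sum_centered_indicator:
  assumes "k > 0" "s < k" shows "(\<Sum>a<k. centered_indicator k a s) = 0"
  using assms by (simp add: centered_indicator_def sum_subtractf of_bool_def)

lemma centered_indicator_commute: "centered_indicator k a s = centered_indicator k s a"
  by (auto simp: centered_indicator_def)

text \<open>The centred indicators are the entries of the projection \<open>I - J / k\<close>, which
  equals its own square, and the kernel is \<open>k\<close> times this projection.\<close>

lemma community_kernel_eq_sum:
  assumes "k > 0" "s < k" "s' < k"
  shows "community_kernel k s s' = real k * (\<Sum>a<k. centered_indicator k a s * centered_indicator k a s')"
proof -
  have "(of_bool (s = a) - c) * (of_bool (s' = a) - c) =
      ((if a = s then of_bool (s = s') else 0) - (if a = s then c else 0) - (if a = s' then c else 0) + c * c :: real)"
    for a c by (simp add: algebra_simps)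
  then have eq: "(\<Sum>a<k. centered_indicator k a s * centered_indicator k a s') = of_bool (s = s') - 1 / real k"
    unfolding centered_indicator_def using assms
    by (simp only: sum.distrib sum_subtractf sum.delta finite_lessThan) simp
  show ?thesis unfolding eq using assms by (simp add: community_kernel_def algebra_simps)
qed

text \<open>Each kernel is a Gram kernel, so their product is the Gram kernel of the tensor
  products, vectors with \<open>k^2\<close> coordinates. Summed over all \<open>i\<close> and
  \<open>j\<close> it is the squared norm of the sum of these vectors.\<close>

lemma quadratic_form_eq_sum_squares:
  assumes k: "k > 0" and \<sigma>: "\<sigma> \<in> {..<n} \<rightarrow>\<^sub>E {..<k}" and \<tau>: "\<tau> \<in> {..<n} \<rightarrow>\<^sub>E {..<k}"
  shows "(\<Sum>i<n. \<Sum>j<n. pair_kernel k \<sigma> \<tau> (i, j)) =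
    (\<Sum>(a, b)\<in>{..<k} \<times> {..<k}. (\<Sum>i<n. real k * (centered_indicator k a (\<sigma> i) * centered_indicator k b (\<tau> i)))\<^sup>2)"
proof -
  let ?c = "centered_indicator k"
  have product: "(real k * sum f {..<k}) * (real k * sum g {..<k}) =
      (\<Sum>a<k. \<Sum>b<k. (real k * f a) * (real k * g b))" for f g :: "nat \<Rightarrow> real"
    unfolding sum_distrib_left[of "real k" f] sum_distrib_left[of "real k" g] by (rule sum_product)
  have "(\<Sum>i<n. \<Sum>j<n. pair_kernel k \<sigma> \<tau> (i, j)) =
    (\<Sum>i<n. \<Sum>j<n. \<Sum>a<k. \<Sum>b<k. (real k * (?c a (\<sigma> i) * ?c b (\<tau> i))) * (real k * (?c a (\<sigma> j) * ?c b (\<tau> j))))"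
  proof (intro sum.cong refl)
    fix i j assume "i \<in> {..<n}" "j \<in> {..<n}"
    then have "\<sigma> i < k" "\<sigma> j < k" "\<tau> i < k" "\<tau> j < k" using \<sigma> \<tau> by auto
    then show "pair_kernel k \<sigma> \<tau> (i, j) =
        (\<Sum>a<k. \<Sum>b<k. (real k * (?c a (\<sigma> i) * ?c b (\<tau> i))) * (real k * (?c a (\<sigma> j) * ?c b (\<tau> j))))"
      using k by (simp add: pair_kernel_def community_kernel_eq_sum product) (simp add: mult_ac)
  qed
  also have "\<dots> = (\<Sum>i<n. \<Sum>a<k. \<Sum>j<n. \<Sum>b<k. (real k * (?c a (\<sigma> i) * ?c b (\<tau> i))) * (real k * (?c a (\<sigma> j) * ?c b (\<tau> j))))"
    by (intro sum.cong refl sum.swap)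
  also have "\<dots> = (\<Sum>a<k. \<Sum>i<n. \<Sum>b<k. \<Sum>j<n. (real k * (?c a (\<sigma> i) * ?c b (\<tau> i))) * (real k * (?c a (\<sigma> j) * ?c b (\<tau> j))))"
    by (subst sum.swap) (intro sum.cong refl sum.swap)
  also have "\<dots> = (\<Sum>a<k. \<Sum>b<k. \<Sum>i<n. \<Sum>j<n. (real k * (?c a (\<sigma> i) * ?c b (\<tau> i))) * (real k * (?c a (\<sigma> j) * ?c b (\<tau> j))))"
    by (intro sum.cong refl sum.swap)
  finally show ?thesis
    by (simp only: sum.cartesian_product[symmetric] power2_eq_square sum_product)
qed

text \<open>The direction of \<open>v\<close> is rounded to a grid of mesh \<open>1 / m\<close>
  inside the unit ball. Each coordinate loses at most \<open>1 / m\<close>, so the inner product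
  loses at most \<open>card I / m \<le> \<delta>\<close> times the norm of \<open>v\<close>. Even
  powers are nonnegative, hence the maximum over the net is at most the sum. The net is chosen
  before \<open>v\<close> and \<open>t\<close>, so its size later counts as a constant.\<close>

lemma finite_net:
  fixes I :: "'a set" and \<delta> :: real
  assumes I: "finite I" and \<delta>: "0 < \<delta>" "\<delta> < 1"
  obtains N :: "('a \<Rightarrow> real) set" where "finite N"
    and "\<And>u. u \<in> N \<Longrightarrow> (\<Sum>i\<in>I. (u i)\<^sup>2) \<le> 1"
    and "\<And>v t. ((1 - \<delta>)\<^sup>2) ^ t * (\<Sum>i\<in>I. (v i)\<^sup>2) ^ t \<le> (\<Sum>u\<in>N. (\<Sum>i\<in>I. u i * v i) ^ (2 * t))"
proof -
  obtain m :: nat where m: "real (card I) / \<delta> < real m" using reals_Archimedean2 by blast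
  have m0: "m > 0" 
  proof -
    have "0 \<le> real (card I) / \<delta>" using \<delta> by simp
    with m have "0 < real m" by linarith
    then show ?thesis by simp
  qed
  have md: "real (card I) / real m \<le> \<delta>" using m m0 \<delta> by (simp add: field_simps)
  define N where "N = {u \<in> I \<rightarrow>\<^sub>E (\<lambda>j. real_of_int j / real m) ` {- int m..int m}. (\<Sum>i\<in>I. (u i)\<^sup>2) \<le> 1}"
  have fin: "finite N" unfolding N_def 
    by (rule finite_subset[of _ "I \<rightarrow>\<^sub>E (\<lambda>j. real_of_int j / real m) ` {- int m..int m}"])
       (auto intro!: finite_PiE I)
  have approx: "\<exists>u\<in>N. (1 - \<delta>) * sqrt (\<Sum>i\<in>I. (v i)\<^sup>2) \<le> (\<Sum>i\<in>I. u i * v i)" for v :: "'a \<Rightarrow> real"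
  proof -
    define r where "r = sqrt (\<Sum>i\<in>I. (v i)\<^sup>2)"
    have r0: "r \<ge> 0" by (simp add: r_def sum_nonneg)
    have r2: "(\<Sum>i\<in>I. (v i)\<^sup>2) = r\<^sup>2" by (simp add: r_def sum_nonneg)
    have vr: "\<bar>v i\<bar> \<le> r" if "i \<in> I" for i
    proof -
      have "(v i)\<^sup>2 \<le> r\<^sup>2" unfolding r2[symmetric] using I that by (intro member_le_sum) auto
      then show ?thesis using r0 abs_le_square_iff[of "v i" r] by simp
    qed
    \<comment> \<open>Rounding is towards zero, which keeps \<open>u\<close> in the unit ball. For
      \<open>r = 0\<close> the convention for division makes \<open>u\<close> zero on
      \<open>I\<close>.\<close>
    define u where "u = restrict (\<lambda>i. sgn (v i) * (real_of_int \<lfloor>real m * (\<bar>v i\<bar> / r)\<rfloor> / real m)) I"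
    have fl: "0 \<le> real_of_int \<lfloor>real m * (\<bar>v i\<bar> / r)\<rfloor>"
      "real_of_int \<lfloor>real m * (\<bar>v i\<bar> / r)\<rfloor> / real m \<le> \<bar>v i\<bar> / r"
      "\<bar>v i\<bar> / r - 1 / real m \<le> real_of_int \<lfloor>real m * (\<bar>v i\<bar> / r)\<rfloor> / real m" for i
    proof -
      let ?x = "real m * (\<bar>v i\<bar> / r)"
      have "0 \<le> ?x" using r0 by simp
      then show "0 \<le> real_of_int \<lfloor>?x\<rfloor>" by simp
      have "real_of_int \<lfloor>?x\<rfloor> \<le> ?x" "?x - 1 \<le> real_of_int \<lfloor>?x\<rfloor>" by linarith+
      then have "real_of_int \<lfloor>?x\<rfloor> / real m \<le> ?x / real m" "(?x - 1) / real m \<le> real_of_int \<lfloor>?x\<rfloor> / real m"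
        by (intro divide_right_mono; simp)+
      then show "real_of_int \<lfloor>?x\<rfloor> / real m \<le> \<bar>v i\<bar> / r" "\<bar>v i\<bar> / r - 1 / real m \<le> real_of_int \<lfloor>?x\<rfloor> / real m"
        using m0 by (simp_all add: diff_divide_distrib)
    qed
    have fl1: "\<lfloor>real m * (\<bar>v i\<bar> / r)\<rfloor> \<le> int m" if "i \<in> I" for i
    proof -
      have "\<bar>v i\<bar> / r \<le> 1" using vr[OF that] r0 by (auto simp: divide_le_eq_1)
      then have "real m * (\<bar>v i\<bar> / r) \<le> real m * 1" by (intro mult_left_mono) simp_all
      then show ?thesis by (simp add: floor_le_iff)
    qed
    have u_abs: "\<bar>u i\<bar> \<le> \<bar>v i\<bar> / r" if "i \<in> I" for i
    proof -
      have "\<bar>u i\<bar> \<le> \<bar>real_of_int \<lfloor>real m * (\<bar>v i\<bar> / r)\<rfloor> / real m\<bar>"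
        using that by (simp add: u_def abs_mult abs_sgn_eq)
      also have "\<dots> \<le> \<bar>v i\<bar> / r" using fl(1,2)[of i] by simp
      finally show ?thesis .
    qed
    have "(\<Sum>i\<in>I. (u i)\<^sup>2) \<le> (\<Sum>i\<in>I. (v i)\<^sup>2 / r\<^sup>2)"
    proof (rule sum_mono)
      fix i assume "i \<in> I"
      then have "\<bar>u i\<bar>\<^sup>2 \<le> (\<bar>v i\<bar> / r)\<^sup>2" using u_abs by (intro power_mono) auto
      then show "(u i)\<^sup>2 \<le> (v i)\<^sup>2 / r\<^sup>2" by (simp add: power_divide)
    qed
    also have "\<dots> \<le> 1" by (simp add: sum_divide_distrib[symmetric] r2)
    finally have norm: "(\<Sum>i\<in>I. (u i)\<^sup>2) \<le> 1" .
    have mem: "u i \<in> (\<lambda>j. real_of_int j / real m) ` {- int m..int m}" if "i \<in> I" for i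
    proof (rule image_eqI)
      define q where "q = \<lfloor>real m * (\<bar>v i\<bar> / r)\<rfloor>"
      have q: "0 \<le> q" "q \<le> int m" using fl(1)[of i] fl1[OF that] by (auto simp: q_def)
      show "u i = real_of_int ((if v i > 0 then 1 else if v i < 0 then - 1 else 0) * q) / real m"
        using that by (simp add: u_def sgn_if q_def)
      show "(if v i > 0 then 1 else if v i < 0 then - 1 else 0) * q \<in> {- int m..int m}"
        using q by auto
    qed
    have "u \<in> N" unfolding N_def using norm mem by (auto simp: u_def)
    moreover have "(1 - \<delta>) * r \<le> (\<Sum>i\<in>I. u i * v i)"
    proof (cases "r = 0")
      case True
      then have "v i = 0" if "i \<in> I" for i using vr[OF that] by simp
      then show ?thesis using True by simp
    next
      case False
      then have r: "r > 0" using r0 by simp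
      have "(1 - \<delta>) * r \<le> (1 - real (card I) / real m) * r" using md r0 by (intro mult_right_mono) auto
      also have "\<dots> = r\<^sup>2 / r - (\<Sum>i\<in>I. r / real m)"
        using r by (simp add: algebra_simps power2_eq_square)
      also have "\<dots> \<le> (\<Sum>i\<in>I. (v i)\<^sup>2) / r - (\<Sum>i\<in>I. \<bar>v i\<bar> / real m)"
        unfolding r2 using vr by (intro diff_left_mono sum_mono divide_right_mono) auto
      also have "\<dots> = (\<Sum>i\<in>I. (\<bar>v i\<bar> / r - 1 / real m) * \<bar>v i\<bar>)"
        by (simp add: sum_divide_distrib sum_subtractf[symmetric] algebra_simps power2_eq_square)
      also have "\<dots> \<le> (\<Sum>i\<in>I. u i * v i)"
      proof (rule sum_mono)
        fix i assume i: "i \<in> I"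
        have "(\<bar>v i\<bar> / r - 1 / real m) * \<bar>v i\<bar> \<le> (real_of_int \<lfloor>real m * (\<bar>v i\<bar> / r)\<rfloor> / real m) * \<bar>v i\<bar>"
          using fl(3) by (intro mult_right_mono) auto
        also have "\<dots> = u i * v i"
          using i by (simp add: u_def sgn_if)
        finally show "(\<bar>v i\<bar> / r - 1 / real m) * \<bar>v i\<bar> \<le> u i * v i" .
      qed
      finally show ?thesis .
    qed
    ultimately show ?thesis unfolding r_def by blast
  qed
  show ?thesis
  proof (rule that[OF fin])
    show "(\<Sum>i\<in>I. (u i)\<^sup>2) \<le> 1" if "u \<in> N" for u using that by (simp add: N_def)
    fix v :: "'a \<Rightarrow> real" and t :: nat
    obtain u where u: "u \<in> N" "(1 - \<delta>) * sqrt (\<Sum>i\<in>I. (v i)\<^sup>2) \<le> (\<Sum>i\<in>I. u i * v i)"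
      using approx by blast
    have "((1 - \<delta>)\<^sup>2) ^ t * (\<Sum>i\<in>I. (v i)\<^sup>2) ^ t = ((1 - \<delta>) * sqrt (\<Sum>i\<in>I. (v i)\<^sup>2)) ^ (2 * t)"
      by (simp add: power_mult_distrib power_mult sum_nonneg)
    also have "\<dots> \<le> (\<Sum>i\<in>I. u i * v i) ^ (2 * t)"
      using u(2) \<delta> by (intro power_mono) (auto simp: sum_nonneg)
    also have "\<dots> \<le> (\<Sum>u\<in>N. (\<Sum>i\<in>I. u i * v i) ^ (2 * t))"
      using fin u(1) by (intro member_le_sum) (auto simp: power_mult)
    finally show "((1 - \<delta>)\<^sup>2) ^ t * (\<Sum>i\<in>I. (v i)\<^sup>2) ^ t \<le> (\<Sum>u\<in>N. (\<Sum>i\<in>I. u i * v i) ^ (2 * t))" .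
  qed
qed

section \<open>Exponential and even moments of sums over the vertices\<close>

lemma pair_mean_prod:
  "pair_mean n k (\<lambda>\<sigma> \<tau>. \<Prod>i<n. g (\<sigma> i) (\<tau> i)) = ((\<Sum>a<k. \<Sum>b<k. g a b) / (real k)\<^sup>2) ^ n"
proof -
  have "(\<Sum>\<tau>\<in>{..<n} \<rightarrow>\<^sub>E {..<k}. \<Prod>i<n. g (\<sigma> i) (\<tau> i)) = (\<Prod>i<n. \<Sum>b<k. g (\<sigma> i) b)" for \<sigma>
    by (rule prod_sum_PiE[symmetric]) auto
  moreover have "(\<Sum>\<sigma>\<in>{..<n} \<rightarrow>\<^sub>E {..<k}. \<Prod>i<n. \<Sum>b<k. g (\<sigma> i) b) = (\<Prod>i<n. \<Sum>a<k. \<Sum>b<k. g a b)"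
    by (rule prod_sum_PiE[symmetric]) auto
  ultimately show ?thesis
    by (simp add: pair_mean_def labelling_mean_def sum_divide_distrib[symmetric] power_divide
        power2_eq_square power_mult_distrib)
qed

text \<open>Taylor's formula with Lagrange remainder, where \<open>exp t / 6 \<le> 1\<close>. It
  keeps the coefficient \<open>1 / 2\<close> of the square exact.\<close>

lemma exp_le_cubic:
  fixes x :: real
  assumes "\<bar>x\<bar> \<le> 1"
  shows "exp x \<le> 1 + x + x\<^sup>2 / 2 + \<bar>x\<bar> ^ 3"
proof -
  obtain t where t: "\<bar>t\<bar> \<le> \<bar>x\<bar>" "exp x = (\<Sum>m<3. x ^ m / fact m) + (exp t / fact 3) * x ^ 3"
    using Maclaurin_exp_le[of x 3] by blast
  have "exp t \<le> exp 1" using t(1) assms by simp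
  also have "\<dots> \<le> 3" by (rule exp_le)
  finally have t6: "exp t / 6 \<le> 1" by simp
  have "x ^ 3 \<le> \<bar>x\<bar> ^ 3" using abs_ge_self[of "x ^ 3"] by (simp only: power_abs)
  then have "(exp t / 6) * x ^ 3 \<le> (exp t / 6) * \<bar>x\<bar> ^ 3" by (intro mult_left_mono) simp_all
  also have "\<dots> \<le> 1 * \<bar>x\<bar> ^ 3" using t6 by (intro mult_right_mono) simp_all
  finally have "(exp t / 6) * x ^ 3 \<le> 1 * \<bar>x\<bar> ^ 3" .
  moreover have "exp x = 1 + x + x\<^sup>2 / 2 + (exp t / 6) * x ^ 3"
    unfolding t(2) by (simp add: eval_nat_numeral)
  ultimately show ?thesis by simp
qed

text \<open>
  The leading coefficient must be the Gaussian one: with a larger constant in place of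
  \<open>1 / 2\<close> the argument would not reach the threshold.
\<close>
lemma pair_mean_exp_le:
  assumes k: "k > 0" and z0: "(\<Sum>a<k. \<Sum>b<k. z a b) = 0"
    and z2: "(\<Sum>a<k. \<Sum>b<k. (z a b)\<^sup>2) \<le> (real k)\<^sup>2"
    and B: "\<And>a b. a < k \<Longrightarrow> b < k \<Longrightarrow> \<bar>z a b\<bar> \<le> B" and s: "\<bar>s\<bar> * B \<le> 1"
  shows "pair_mean n k (\<lambda>\<sigma> \<tau>. exp (s * (\<Sum>i<n. z (\<sigma> i) (\<tau> i)))) \<le> exp (real n * (s\<^sup>2 / 2 + \<bar>s\<bar> ^ 3 * B))"
proof -
  define y where "y = s\<^sup>2 / 2 + \<bar>s\<bar> ^ 3 * B"
  have B0: "B \<ge> 0" using B[of 0 0] k by linarith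
  have y0: "y \<ge> 0" using B0 by (simp add: y_def)
  have "(\<Sum>a<k. \<Sum>b<k. exp (s * z a b)) \<le> (\<Sum>a<k. \<Sum>b<k. 1 + s * z a b + y * (z a b)\<^sup>2)"
  proof (intro sum_mono)
    fix a b assume "a \<in> {..<k}" "b \<in> {..<k}"
    then have zB: "\<bar>z a b\<bar> \<le> B" using B by simp
    then have "\<bar>s * z a b\<bar> \<le> \<bar>s\<bar> * B" by (simp add: abs_mult mult_left_mono)
    then have "exp (s * z a b) \<le> 1 + s * z a b + (s * z a b)\<^sup>2 / 2 + \<bar>s * z a b\<bar> ^ 3"
      using s by (intro exp_le_cubic) simp
    \<comment> \<open>Two factors of \<open>z a b\<close> are kept and only the third is bounded by
      \<open>B\<close>, so the cubic error joins the coefficient \<open>y\<close> of the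
      square.\<close>
    also have "\<bar>s * z a b\<bar> ^ 3 = \<bar>s\<bar> ^ 3 * \<bar>z a b\<bar> * (z a b)\<^sup>2"
    proof -
      have "\<bar>z a b\<bar> ^ 3 = \<bar>z a b\<bar> * (z a b)\<^sup>2"
        by (simp add: power3_eq_cube power2_eq_square mult.commute)
      then show ?thesis by (simp add: abs_mult power_mult_distrib)
    qed
    also have "\<dots> \<le> \<bar>s\<bar> ^ 3 * B * (z a b)\<^sup>2" using zB by (intro mult_right_mono mult_left_mono) auto
    finally show "exp (s * z a b) \<le> 1 + s * z a b + y * (z a b)\<^sup>2"
      by (simp add: y_def power_mult_distrib algebra_simps)
  qed
  \<comment> \<open>The linear term disappears because the scores sum to zero.\<close>
  also have "\<dots> = (real k)\<^sup>2 + y * (\<Sum>a<k. \<Sum>b<k. (z a b)\<^sup>2)"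
    using z0 by (simp add: sum.distrib sum_distrib_left[symmetric] power2_eq_square[of "real k"])
  also have "\<dots> \<le> (real k)\<^sup>2 + y * (real k)\<^sup>2" using z2 y0 by (intro add_left_mono mult_left_mono)
  finally have "(\<Sum>a<k. \<Sum>b<k. exp (s * z a b)) / (real k)\<^sup>2 \<le> 1 + y"
    using k by (simp add: divide_le_eq algebra_simps)
  also have "\<dots> \<le> exp y" by (rule exp_ge_add_one_self)
  finally have "((\<Sum>a<k. \<Sum>b<k. exp (s * z a b)) / (real k)\<^sup>2) ^ n \<le> exp y ^ n"
    by (intro power_mono) (auto intro!: divide_nonneg_nonneg sum_nonneg)
  then show ?thesis
    unfolding pair_mean_prod[symmetric] y_def
    by (simp add: sum_distrib_left exp_sum exp_of_nat_mult[symmetric])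
qed

text \<open>A single term of the exponential series at \<open>\<bar>x\<bar>\<close>; the larger of
  the two exponentials on the right equals \<open>exp \<bar>x\<bar>\<close>. This passes from
  exponential moments to even moments.\<close>

lemma even_power_le_exp:
  fixes x :: real
  shows "x ^ (2 * t) \<le> fact (2 * t) * (exp x + exp (- x))"
proof -
  have pow: "y ^ (2 * t) \<le> fact (2 * t) * exp y" if y: "y \<ge> 0" for y :: real
  proof -
    obtain h where "exp y = (\<Sum>i<Suc (2 * t). y ^ i / fact i) + (exp h / fact (Suc (2 * t))) * y ^ Suc (2 * t)"
      using Maclaurin_exp_le[of y "Suc (2 * t)"] by blast
    moreover have "y ^ (2 * t) / fact (2 * t) \<le> (\<Sum>i<Suc (2 * t). y ^ i / fact i)"
      using y by (intro member_le_sum) auto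
    ultimately have "y ^ (2 * t) / fact (2 * t) \<le> exp y" using y by simp
    then show ?thesis by (simp add: divide_le_eq mult.commute)
  qed
  have "x ^ (2 * t) = \<bar>x\<bar> ^ (2 * t)" by (simp add: power_mult)
  also have "\<dots> \<le> fact (2 * t) * exp \<bar>x\<bar>" by (rule pow) simp
  also have "\<dots> \<le> fact (2 * t) * (exp x + exp (- x))"
    by (intro mult_left_mono) (auto simp: abs_if)
  finally show ?thesis .
qed

text \<open>Chernoff's method with the exponential bound at \<open>s\<close> and at
  \<open>- s\<close>; the parameter \<open>s\<close> stays free to be optimised later.\<close>

lemma pair_mean_even_moment_le:
  assumes k: "k > 0" and z0: "(\<Sum>a<k. \<Sum>b<k. z a b) = 0"
    and z2: "(\<Sum>a<k. \<Sum>b<k. (z a b)\<^sup>2) \<le> (real k)\<^sup>2"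
    and B: "\<And>a b. a < k \<Longrightarrow> b < k \<Longrightarrow> \<bar>z a b\<bar> \<le> B" and s: "0 < s" "s * B \<le> 1"
  shows "s ^ (2 * t) * pair_mean n k (\<lambda>\<sigma> \<tau>. (\<Sum>i<n. z (\<sigma> i) (\<tau> i)) ^ (2 * t)) \<le>
    fact (2 * t) * (2 * exp (real n * (s\<^sup>2 / 2 + s ^ 3 * B)))"
proof -
  let ?Z = "\<lambda>\<sigma> \<tau>. \<Sum>i<n. z (\<sigma> i) (\<tau> i)"
  have "s ^ (2 * t) * pair_mean n k (\<lambda>\<sigma> \<tau>. ?Z \<sigma> \<tau> ^ (2 * t)) =
      pair_mean n k (\<lambda>\<sigma> \<tau>. (s * ?Z \<sigma> \<tau>) ^ (2 * t))"
    by (simp only: pair_mean_cmult[symmetric] power_mult_distrib)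
  also have "\<dots> \<le> pair_mean n k (\<lambda>\<sigma> \<tau>. fact (2 * t) * (exp (s * ?Z \<sigma> \<tau>) + exp ((- s) * ?Z \<sigma> \<tau>)))"
    using even_power_le_exp by (intro pair_mean_mono) (simp only: mult_minus_left)
  also have "\<dots> = fact (2 * t) * (pair_mean n k (\<lambda>\<sigma> \<tau>. exp (s * ?Z \<sigma> \<tau>)) +
      pair_mean n k (\<lambda>\<sigma> \<tau>. exp ((- s) * ?Z \<sigma> \<tau>)))"
    by (simp only: pair_mean_cmult pair_mean_add)
  also have "\<dots> \<le> fact (2 * t) * (exp (real n * (s\<^sup>2 / 2 + \<bar>s\<bar> ^ 3 * B)) + exp (real n * ((- s)\<^sup>2 / 2 + \<bar>- s\<bar> ^ 3 * B)))"
    using s by (intro mult_left_mono add_mono pair_mean_exp_le[OF k z0 z2 B]) auto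
  finally show ?thesis using s by simp
qed

text \<open>Stirling's upper bound up to a factor linear in \<open>t\<close>, which is harmless
  beside geometric growth. The induction step amounts to
  \<open>(1 - 1 / (t + 1)) ^ (t + 1) \<le> 1 / e\<close>.\<close>

lemma fact_exp_le:
  assumes "t \<ge> 1"
  shows "fact t * exp (real t) \<le> exp 1 * real t * real t ^ t"
  using assms
proof (induction t rule: nat_induct_at_least)
  case base
  then show ?case by simp
next
  case (Suc t)
  let ?r = "1 - 1 / real (Suc t)"
  have "?r \<le> exp (- (1 / real (Suc t)))" using exp_ge_add_one_self[of "- (1 / real (Suc t))"] by simp
  then have "?r ^ Suc t \<le> exp (- (1 / real (Suc t))) ^ Suc t" by (intro power_mono) simp_all
  also have "\<dots> = exp (- 1)" by (simp only: exp_of_nat_mult[symmetric]) simp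
  finally have "exp 1 * ?r ^ Suc t \<le> 1" by (simp add: exp_minus field_simps)
  moreover have "real t ^ Suc t = ?r ^ Suc t * real (Suc t) ^ Suc t"
  proof -
    have "?r * real (Suc t) = real t" by (simp add: field_simps)
    then show ?thesis by (simp only: power_mult_distrib[symmetric])
  qed
  ultimately have key: "exp 1 * real t ^ Suc t \<le> real (Suc t) ^ Suc t"
    using mult_right_mono[of "exp 1 * ?r ^ Suc t" 1 "real (Suc t) ^ Suc t"] by (simp add: mult.assoc)
  have "fact (Suc t) * exp (real (Suc t)) = real (Suc t) * exp 1 * (fact t * exp (real t))"
    by (simp add: exp_add algebra_simps)
  also have "\<dots> \<le> real (Suc t) * exp 1 * (exp 1 * real t * real t ^ t)"
    using Suc.IH by (intro mult_left_mono) auto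
  also have "\<dots> = real (Suc t) * exp 1 * (exp 1 * real t ^ Suc t)" by simp
  also have "\<dots> \<le> real (Suc t) * exp 1 * real (Suc t) ^ Suc t" using key by (intro mult_left_mono) auto
  finally show ?case by (simp add: mult_ac)
qed

text \<open>The central binomial coefficient is at most \<open>2 ^ (2 * t)\<close>.\<close>

lemma fact_double_le: "(fact (2 * t) :: real) \<le> 4 ^ t * (fact t)\<^sup>2"
proof -
  have "(fact (2 * t) :: real) = (fact t)\<^sup>2 * real (2 * t choose t)"
  proof -
    have "fact t * fact (2 * t - t) * (2 * t choose t) = (fact (2 * t) :: nat)"
      by (rule binomial_fact_lemma) simp
    then have "real (fact t * fact (2 * t - t) * (2 * t choose t)) = real (fact (2 * t))"
      by (simp only:)
    then show ?thesis by (simp add: power2_eq_square)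
  qed
  also have "\<dots> \<le> (fact t)\<^sup>2 * 4 ^ t"
  proof (rule mult_left_mono)
    have "2 * t choose t \<le> 4 ^ t" using binomial_le_pow2[of "2 * t" t] by (simp add: power_mult)
    then have "real (2 * t choose t) \<le> real (4 ^ t)" by (simp only: of_nat_le_iff)
    then show "real (2 * t choose t) \<le> 4 ^ t" by simp
  qed simp
  finally show ?thesis by (simp add: mult.commute)
qed

section \<open>Linear functionals of the vector contributed by one vertex\<close>

lemma centered_indicator_contraction:
  assumes k: "k > 0"
  shows "(\<Sum>s<k. (\<Sum>a<k. v a * centered_indicator k a s)\<^sup>2) \<le> (\<Sum>a<k. (v a)\<^sup>2)"
proof -
  define V where "V = (\<Sum>a<k. v a)"
  \<comment> \<open>This is the orthogonal projection off the constants: it subtracts the mean from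
    \<open>v\<close>, and the squared norm drops by \<open>V^2 / k\<close>.\<close>
  have "(\<Sum>a<k. v a * centered_indicator k a s) = v s - V / real k" if "s < k" for s
  proof -
    have "v a * centered_indicator k a s = (if a = s then v a else 0) - v a / real k" for a
      by (simp add: centered_indicator_def right_diff_distrib)
    then show ?thesis using that by (simp add: sum_subtractf V_def sum_divide_distrib)
  qed
  then have "(\<Sum>s<k. (\<Sum>a<k. v a * centered_indicator k a s)\<^sup>2) = (\<Sum>s<k. (v s - V / real k)\<^sup>2)"
    by simp
  also have "\<dots> = (\<Sum>s<k. (v s)\<^sup>2 - 2 * (V / real k) * v s + (V / real k)\<^sup>2)"
    by (simp add: power2_diff algebra_simps)
  also have "\<dots> = (\<Sum>s<k. (v s)\<^sup>2) - 2 * (V / real k) * V + real k * (V / real k)\<^sup>2"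
    unfolding V_def sum_distrib_left by (simp add: sum.distrib sum_subtractf)
  also have "\<dots> = (\<Sum>s<k. (v s)\<^sup>2) - V\<^sup>2 / real k"
    using k by (simp add: power2_eq_square field_simps)
  finally show ?thesis by simp
qed

text \<open>The inner product of \<open>u\<close> with the vector that a vertex labelled
  \<open>s\<close> and \<open>t\<close> contributes to the quadratic form.\<close>

definition linear_score :: "nat \<Rightarrow> (nat \<times> nat \<Rightarrow> real) \<Rightarrow> nat \<Rightarrow> nat \<Rightarrow> real" where
  "linear_score k u s t =
     (\<Sum>(a, b)\<in>{..<k} \<times> {..<k}. u (a, b) * (real k * (centered_indicator k a s * centered_indicator k b t)))"

lemma linear_score_eq:
  "linear_score k u s t =
    real k * (\<Sum>b<k. (\<Sum>a<k. u (a, b) * centered_indicator k a s) * centered_indicator k b t)"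
proof -
  have "linear_score k u s t = (\<Sum>a<k. \<Sum>b<k. u (a, b) * (real k * (centered_indicator k a s * centered_indicator k b t)))"
    by (simp add: linear_score_def sum.cartesian_product)
  also have "\<dots> = (\<Sum>b<k. \<Sum>a<k. u (a, b) * (real k * (centered_indicator k a s * centered_indicator k b t)))"
    by (rule sum.swap)
  finally show ?thesis by (simp add: sum_distrib_left sum_distrib_right mult_ac)
qed

lemma sum_linear_score:
  assumes "k > 0"
  shows "(\<Sum>s<k. \<Sum>t<k. linear_score k u s t) = 0"
proof -
  have "(\<Sum>t<k. centered_indicator k b t) = 0" if "b < k" for b
    using sum_centered_indicator[OF assms that] by (simp add: centered_indicator_commute[of k b])
  then have "(\<Sum>b<k. \<Sum>t<k. x b * centered_indicator k b t) = 0" for x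
    by (simp add: sum_distrib_left[symmetric])
  then have "(\<Sum>t<k. \<Sum>b<k. x b * centered_indicator k b t) = 0" for x
    by (subst sum.swap)
  then have "(\<Sum>t<k. linear_score k u s t) = 0" for s
    by (simp only: linear_score_eq sum_distrib_left[symmetric] mult_zero_right)
  then show ?thesis by simp
qed

text \<open>The contraction is applied in each of the two label indices. Averaged over the
  \<open>k^2\<close> label pairs, a functional from the unit ball has variance at most 1, which is
  what the sharp threshold requires.\<close>

lemma sum_linear_score_sq:
  assumes k: "k > 0" and u: "(\<Sum>i\<in>{..<k} \<times> {..<k}. (u i)\<^sup>2) \<le> 1"
  shows "(\<Sum>s<k. \<Sum>t<k. (linear_score k u s t)\<^sup>2) \<le> (real k)\<^sup>2"
proof -
  let ?c = "centered_indicator k"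
  have "(\<Sum>s<k. \<Sum>t<k. (linear_score k u s t)\<^sup>2) =
      (real k)\<^sup>2 * (\<Sum>s<k. \<Sum>t<k. (\<Sum>b<k. (\<Sum>a<k. u (a, b) * ?c a s) * ?c b t)\<^sup>2)"
    by (simp only: linear_score_eq power_mult_distrib sum_distrib_left[symmetric])
  also have "\<dots> \<le> (real k)\<^sup>2 * (\<Sum>s<k. \<Sum>b<k. (\<Sum>a<k. u (a, b) * ?c a s)\<^sup>2)"
    by (rule mult_left_mono[OF sum_mono[OF centered_indicator_contraction[OF k]]]) simp
  also have "\<dots> = (real k)\<^sup>2 * (\<Sum>b<k. \<Sum>s<k. (\<Sum>a<k. u (a, b) * ?c a s)\<^sup>2)"
    by (subst sum.swap) simp
  also have "\<dots> \<le> (real k)\<^sup>2 * (\<Sum>b<k. \<Sum>a<k. (u (a, b))\<^sup>2)"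
    by (rule mult_left_mono[OF sum_mono[OF centered_indicator_contraction[OF k]]]) simp
  also have "(\<Sum>b<k. \<Sum>a<k. (u (a, b))\<^sup>2) = (\<Sum>i\<in>{..<k} \<times> {..<k}. (u i)\<^sup>2)"
    by (subst sum.swap) (simp add: sum.cartesian_product)
  also have "(real k)\<^sup>2 * \<dots> \<le> (real k)\<^sup>2 * 1" using u by (intro mult_left_mono) auto
  finally show ?thesis by simp
qed

text \<open>A crude count, \<open>k^2\<close> terms of size at most \<open>k\<close>. It suffices
  because this bound enters only the cubic error, so any constant free of \<open>n\<close> will
  do.\<close>

lemma abs_linear_score_le:
  assumes k: "k > 0" and u: "(\<Sum>i\<in>{..<k} \<times> {..<k}. (u i)\<^sup>2) \<le> 1"
  shows "\<bar>linear_score k u s t\<bar> \<le> real k ^ 3"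
proof -
  have c: "\<bar>centered_indicator k a s\<bar> \<le> 1" for a s
    using k by (auto simp: centered_indicator_def abs_if field_simps)
  have "\<bar>u i * (real k * (centered_indicator k (fst i) s * centered_indicator k (snd i) t))\<bar> \<le> real k"
    if "i \<in> {..<k} \<times> {..<k}" for i
  proof -
    have "(u i)\<^sup>2 \<le> (\<Sum>i\<in>{..<k} \<times> {..<k}. (u i)\<^sup>2)" using that by (intro member_le_sum) auto
    then have "\<bar>u i\<bar> \<le> 1" using u by (simp add: abs_square_le_1[symmetric])
    moreover have "\<bar>centered_indicator k (fst i) s\<bar> * \<bar>centered_indicator k (snd i) t\<bar> \<le> 1"
      using c by (intro mult_le_one c) auto
    ultimately have "\<bar>u i\<bar> * (\<bar>centered_indicator k (fst i) s\<bar> * \<bar>centered_indicator k (snd i) t\<bar>) \<le> 1"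
      using mult_le_one[of "\<bar>u i\<bar>" "\<bar>centered_indicator k (fst i) s\<bar> * \<bar>centered_indicator k (snd i) t\<bar>"]
      by simp
    then have "real k * (\<bar>u i\<bar> * (\<bar>centered_indicator k (fst i) s\<bar> * \<bar>centered_indicator k (snd i) t\<bar>)) \<le> real k * 1"
      by (intro mult_left_mono) auto
    then show ?thesis by (simp add: abs_mult mult_ac)
  qed
  then have "(\<Sum>i\<in>{..<k} \<times> {..<k}. \<bar>u i * (real k * (centered_indicator k (fst i) s * centered_indicator k (snd i) t))\<bar>)
      \<le> (\<Sum>i\<in>{..<k} \<times> {..<k}. real k)" by (rule sum_mono)
  also have "\<dots> = real k ^ 3" by (simp add: power3_eq_cube)
  finally show ?thesis
    unfolding linear_score_def case_prod_unfold prod.collapse by (rule order_trans[OF sum_abs])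
qed

text \<open>The quadratic form is a squared norm, the net reduces its power to even moments of
  scores, and Chernoff bounds these. The choice of \<open>s\<close> minimises
  \<open>exp (n * s^2 / 2) / s ^ (2 * t)\<close>, where the exponent equals \<open>t\<close>; the
  factorial bounds then leave \<open>n ^ t\<close> up to polynomial and error factors.\<close>

lemma sum_subgraph_moment_le:
  assumes k: "k > 0" and n: "n > 0" and t: "t \<ge> 1" and \<delta>: "\<delta> < 1"
    and N: "finite N" "\<And>u. u \<in> N \<Longrightarrow> (\<Sum>i\<in>{..<k} \<times> {..<k}. (u i)\<^sup>2) \<le> 1"
      "\<And>v t. ((1 - \<delta>)\<^sup>2) ^ t * (\<Sum>i\<in>{..<k} \<times> {..<k}. (v i)\<^sup>2) ^ t \<le>
        (\<Sum>u\<in>N. (\<Sum>i\<in>{..<k} \<times> {..<k}. u i * v i) ^ (2 * t))"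
    and s: "s = sqrt (2 * real t / real n)" "s * real k ^ 3 \<le> 1"
  shows "(\<Sum>S | S \<subseteq> vertex_pairs n \<and> card S = t. (subgraph_moment n k S)\<^sup>2) \<le>
    2 * exp 1 * real (card N) * real t * (real n * exp (2 * s * real k ^ 3) / (1 - \<delta>)\<^sup>2) ^ t"
    (is "?SS \<le> _")
proof -
  let ?c = "centered_indicator k"
  let ?W = "\<lambda>\<sigma> \<tau> (a, b). \<Sum>i<n. real k * (?c a (\<sigma> i) * ?c b (\<tau> i))"
  define B where "B = real k ^ 3"
  define Q where "Q = pair_mean n k (\<lambda>\<sigma> \<tau>. (\<Sum>i<n. \<Sum>j<n. pair_kernel k \<sigma> \<tau> (i, j)) ^ t)"
  have s0: "s > 0" using s n t by simp
  have s2: "s\<^sup>2 = 2 * real t / real n" using s by simp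
  have score: "(\<Sum>i\<in>{..<k} \<times> {..<k}. u i * ?W \<sigma> \<tau> i) = (\<Sum>i<n. linear_score k u (\<sigma> i) (\<tau> i))" for u \<sigma> \<tau>
    unfolding linear_score_def by (subst sum.swap) (simp add: case_prod_unfold sum_distrib_left)
  have double: "fact (2 * t) * exp (real t) \<le> 4 ^ t * fact t * (exp 1 * real t * real t ^ t)"
  proof -
    have "fact (2 * t) * exp (real t) \<le> 4 ^ t * (fact t)\<^sup>2 * exp (real t)"
      using fact_double_le by (intro mult_right_mono) auto
    also have "\<dots> = 4 ^ t * fact t * (fact t * exp (real t))" by (simp add: power2_eq_square)
    also have "\<dots> \<le> 4 ^ t * fact t * (exp 1 * real t * real t ^ t)"
      using fact_exp_le[OF t] by (intro mult_left_mono) auto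
    finally show ?thesis .
  qed
  have "((1 - \<delta>)\<^sup>2) ^ t * Q =
      pair_mean n k (\<lambda>\<sigma> \<tau>. ((1 - \<delta>)\<^sup>2) ^ t * (\<Sum>i<n. \<Sum>j<n. pair_kernel k \<sigma> \<tau> (i, j)) ^ t)"
    by (simp add: Q_def pair_mean_cmult)
  also have "\<dots> \<le> pair_mean n k (\<lambda>\<sigma> \<tau>. \<Sum>u\<in>N. (\<Sum>i<n. linear_score k u (\<sigma> i) (\<tau> i)) ^ (2 * t))"
  proof (rule pair_mean_mono)
    fix \<sigma> \<tau> assume "\<sigma> \<in> {..<n} \<rightarrow>\<^sub>E {..<k}" "\<tau> \<in> {..<n} \<rightarrow>\<^sub>E {..<k}"
    then have "(\<Sum>i<n. \<Sum>j<n. pair_kernel k \<sigma> \<tau> (i, j)) = (\<Sum>i\<in>{..<k} \<times> {..<k}. (?W \<sigma> \<tau> i)\<^sup>2)"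
      by (simp add: quadratic_form_eq_sum_squares[OF k] case_prod_unfold)
    then show "((1 - \<delta>)\<^sup>2) ^ t * (\<Sum>i<n. \<Sum>j<n. pair_kernel k \<sigma> \<tau> (i, j)) ^ t \<le>
        (\<Sum>u\<in>N. (\<Sum>i<n. linear_score k u (\<sigma> i) (\<tau> i)) ^ (2 * t))"
      using N(3)[of t "?W \<sigma> \<tau>"] by (simp only: score)
  qed
  finally have "s ^ (2 * t) * (((1 - \<delta>)\<^sup>2) ^ t * Q) \<le>
      (\<Sum>u\<in>N. s ^ (2 * t) * pair_mean n k (\<lambda>\<sigma> \<tau>. (\<Sum>i<n. linear_score k u (\<sigma> i) (\<tau> i)) ^ (2 * t)))"
    using s0 by (simp only: pair_mean_sum sum_distrib_left[symmetric]) (simp add: mult_left_mono)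
  also have "\<dots> \<le> (\<Sum>u\<in>N. fact (2 * t) * (2 * exp (real n * (s\<^sup>2 / 2 + s ^ 3 * B))))"
    using k N(2) s0 s(2) unfolding B_def
    by (intro sum_mono pair_mean_even_moment_le sum_linear_score sum_linear_score_sq abs_linear_score_le) auto
  also have "real n * (s\<^sup>2 / 2 + s ^ 3 * B) = real t + real t * (2 * s * B)"
  proof -
    have "real n * (s\<^sup>2 / 2 + s ^ 3 * B) = real n * s\<^sup>2 * (1 / 2 + s * B)"
      by (simp add: power3_eq_cube power2_eq_square algebra_simps)
    also have "real n * s\<^sup>2 = 2 * real t" using n by (simp add: s2)
    finally show ?thesis by (simp add: algebra_simps)
  qed
  also have "exp (real t + real t * (2 * s * B)) = exp (real t) * exp (2 * s * B) ^ t"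
    by (simp add: exp_add exp_of_nat_mult)
  finally have "s ^ (2 * t) * (((1 - \<delta>)\<^sup>2) ^ t * Q) \<le>
      2 * real (card N) * exp (2 * s * B) ^ t * (fact (2 * t) * exp (real t))"
    by (simp add: mult_ac)
  also have "\<dots> \<le>
      2 * real (card N) * exp (2 * s * B) ^ t * (4 ^ t * fact t * (exp 1 * real t * real t ^ t))"
    using double by (intro mult_left_mono) auto
  finally have 1: "s ^ (2 * t) * (((1 - \<delta>)\<^sup>2) ^ t * Q) \<le>
      2 * real (card N) * exp (2 * s * B) ^ t * (4 ^ t * fact t * (exp 1 * real t * real t ^ t))" .
  \<comment> \<open>One \<open>2 ^ t\<close> comes from halving the form, the other from
    \<open>s ^ (2 * t)\<close>; together they cancel the \<open>4 ^ t\<close> of the factorial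
    bound, so the geometric rate carries no constant beyond the error factors.\<close>
  have four: "(4::real) ^ t = 2 ^ t * 2 ^ t" by (simp add: power_mult_distrib[symmetric])
  have "fact t * ?SS * 2 ^ t \<le> Q"
    using sum_subgraph_moment_le_quadratic_form[of t n k] by (simp add: Q_def pos_le_divide_eq)
  then have "s ^ (2 * t) * (((1 - \<delta>)\<^sup>2) ^ t * (fact t * ?SS * 2 ^ t)) \<le> s ^ (2 * t) * (((1 - \<delta>)\<^sup>2) ^ t * Q)"
    using s0 by (intro mult_left_mono) auto
  also note 1
  also have "s ^ (2 * t) = (2 * real t) ^ t / real n ^ t"
    by (simp add: power_mult s2 power_divide)
  finally have "(fact t * 4 ^ t * real t ^ t) * (((1 - \<delta>)\<^sup>2) ^ t / real n ^ t * ?SS) \<le>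
      (fact t * 4 ^ t * real t ^ t) * (2 * exp 1 * real (card N) * real t * exp (2 * s * B) ^ t)"
    unfolding four by (simp add: power_mult_distrib mult_ac)
  then have "((1 - \<delta>)\<^sup>2) ^ t / real n ^ t * ?SS \<le> 2 * exp 1 * real (card N) * real t * exp (2 * s * B) ^ t"
    using t by (subst (asm) mult_le_cancel_left_pos) auto
  moreover have pos: "((1 - \<delta>)\<^sup>2) ^ t > 0" "real n ^ t > 0" using \<delta> n by auto
  ultimately have "?SS \<le> 2 * exp 1 * real (card N) * real t * exp (2 * s * B) ^ t / (((1 - \<delta>)\<^sup>2) ^ t / real n ^ t)"
    by (subst pos_le_divide_eq) (simp_all add: mult.commute)
  also have "\<dots> = 2 * exp 1 * real (card N) * real t * (real n * exp (2 * s * B) / (1 - \<delta>)\<^sup>2) ^ t"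
    by (simp only: power_mult_distrib power_divide divide_divide_eq_right times_divide_eq_right mult_ac)
  finally show ?thesis by (simp only: B_def)
qed

text \<open>Edge sets are grouped by their size. The condition on \<open>\<rho>\<close> makes the
  geometric factor of every layer at most 1, so each of the \<open>l + 1\<close> layers is at most
  \<open>C * (l + 1)\<close>. The constant depends on \<open>k\<close> and \<open>\<delta>\<close>
  only, through the size of the net.\<close>

lemma low_degree_norm_sq_le:
  assumes k: "k > 0" and \<delta>: "0 < \<delta>" "\<delta> < 1"
  obtains C :: real where "C \<ge> 1"
    and "\<And>n l \<rho>. n > 0 \<Longrightarrow> \<rho> \<ge> 0 \<Longrightarrow> sqrt (2 * real l / real n) * real k ^ 3 \<le> 1 \<Longrightarrow>
      \<rho> * real n * exp (2 * sqrt (2 * real l / real n) * real k ^ 3) \<le> (1 - \<delta>)\<^sup>2 \<Longrightarrow>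
      low_degree_norm_sq n k \<rho> l \<le> C * (real l + 1)\<^sup>2"
proof -
  obtain N :: "(nat \<times> nat \<Rightarrow> real) set" where N: "finite N"
    "\<And>u. u \<in> N \<Longrightarrow> (\<Sum>i\<in>{..<k} \<times> {..<k}. (u i)\<^sup>2) \<le> 1"
    "\<And>v t. ((1 - \<delta>)\<^sup>2) ^ t * (\<Sum>i\<in>{..<k} \<times> {..<k}. (v i)\<^sup>2) ^ t \<le>
        (\<Sum>u\<in>N. (\<Sum>i\<in>{..<k} \<times> {..<k}. u i * v i) ^ (2 * t))"
    using finite_net[OF _ \<delta>, of "{..<k} \<times> {..<k}"] by auto
  define C where "C = 1 + 2 * exp 1 * real (card N)"
  have C: "C \<ge> 1" by (simp add: C_def)
  show ?thesis
  proof (rule that[OF C])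
    fix n l :: nat and \<rho> :: real
    assume n: "n > 0" and \<rho>: "\<rho> \<ge> 0" and s1: "sqrt (2 * real l / real n) * real k ^ 3 \<le> 1"
      and s2: "\<rho> * real n * exp (2 * sqrt (2 * real l / real n) * real k ^ 3) \<le> (1 - \<delta>)\<^sup>2"
    let ?SS = "\<lambda>t. \<Sum>S | S \<subseteq> vertex_pairs n \<and> card S = t. (subgraph_moment n k S)\<^sup>2"
    let ?F = "{S. S \<subseteq> vertex_pairs n \<and> card S \<le> l}"
    have finF: "finite ?F" by (rule finite_subset[of _ "Pow (vertex_pairs n)"]) auto
    have layer: "\<rho> ^ t * ?SS t \<le> C * (real l + 1)" if tl: "t \<le> l" for t
    proof (cases "t = 0")
      case True
      have "{S. S \<subseteq> vertex_pairs n \<and> card S = 0} = {{}}"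
        using finite_subset[OF _ finite_vertex_pairs] by auto
      then show ?thesis using True k C mult_mono[of 1 C 1 "real l + 1"] by simp
    next
      case False
      define s where "s = sqrt (2 * real t / real n)"
      have sl: "s \<le> sqrt (2 * real l / real n)" using tl by (simp add: s_def divide_right_mono)
      have "s * real k ^ 3 \<le> sqrt (2 * real l / real n) * real k ^ 3" using sl by (intro mult_right_mono) auto
      with s1 have s3: "s * real k ^ 3 \<le> 1" by linarith
      have "\<rho> * (real n * exp (2 * s * real k ^ 3)) \<le> \<rho> * real n * exp (2 * sqrt (2 * real l / real n) * real k ^ 3)"
        using sl \<rho> unfolding mult.assoc by (intro mult_left_mono) (auto intro!: mult_right_mono)
      with s2 have "\<rho> * (real n * exp (2 * s * real k ^ 3)) \<le> (1 - \<delta>)\<^sup>2" by linarith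
      then have q: "\<rho> * (real n * exp (2 * s * real k ^ 3) / (1 - \<delta>)\<^sup>2) \<le> 1"
        using \<delta> by (simp add: divide_le_eq)
      have "\<rho> ^ t * ?SS t \<le> \<rho> ^ t * (2 * exp 1 * real (card N) * real t *
          (real n * exp (2 * s * real k ^ 3) / (1 - \<delta>)\<^sup>2) ^ t)"
        using False \<rho> by (intro mult_left_mono sum_subgraph_moment_le[OF k n _ \<delta>(2) N s_def s3]) auto
      also have "\<dots> = 2 * exp 1 * real (card N) * real t *
          (\<rho> * (real n * exp (2 * s * real k ^ 3) / (1 - \<delta>)\<^sup>2)) ^ t"
        by (simp only: power_mult_distrib mult_ac)
      also have "\<dots> \<le> 2 * exp 1 * real (card N) * real t * 1"
        using q \<rho> by (intro mult_left_mono power_le_one) auto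
      also have "\<dots> \<le> C * (real l + 1)"
        using tl unfolding C_def mult_1_right by (intro mult_mono) auto
      finally show ?thesis .
    qed
    have "low_degree_norm_sq n k \<rho> l =
        (\<Sum>t\<le>l. \<Sum>S\<in>{S\<in>?F. card S = t}. \<rho> ^ card S * (subgraph_moment n k S)\<^sup>2)"
      unfolding low_degree_norm_sq_def by (rule sum.group[symmetric]) (use finF in auto)
    also have "\<dots> = (\<Sum>t\<le>l. \<rho> ^ t * ?SS t)"
      unfolding sum_distrib_left by (intro sum.cong) auto
    also have "\<dots> \<le> (\<Sum>t\<le>l. C * (real l + 1))" using layer by (intro sum_mono) auto
    also have "\<dots> = C * (real l + 1)\<^sup>2" by (simp add: power2_eq_square algebra_simps)
    finally show "low_degree_norm_sq n k \<rho> l \<le> C * (real l + 1)\<^sup>2" .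
  qed
qed

section \<open>The threshold\<close>

lemma eventually_max_low_degree_ratio_eq:
  fixes d \<epsilon> :: real
  assumes d: "d > 0" and k: "k \<ge> 2"
    and prob: "\<forall>\<^sub>F n in sequentially. \<forall>same. sbm_edge_prob n d \<epsilon> k same \<in> {0..1}"
  shows "\<forall>\<^sub>F n in sequentially. d < real n \<and> (\<forall>l. max_low_degree_ratio n d \<epsilon> k l =
    sqrt (low_degree_norm_sq n k (\<epsilon>\<^sup>2 * d / (real k)\<^sup>2 / (real n - d)) l))"
proof -
  have "\<forall>\<^sub>F n in sequentially. d < real n" by real_asymp
  with prob show ?thesis
    by eventually_elim (use d k in \<open>simp add: max_low_degree_ratio_eq\<close>)
qed

text \<open>Cycles of one length \<open>m\<close> near \<open>C * ln n\<close> already give a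
  squared norm of order \<open>\<Lambda> ^ m / n^2\<close>; a larger degree only adds nonnegative
  terms.\<close>

lemma eventually_max_low_degree_ratio_ge:
  fixes d \<epsilon> :: real
  assumes d: "d > 0" and k: "k \<ge> 2"
    and prob: "\<forall>\<^sub>F n in sequentially. \<forall>same. sbm_edge_prob n d \<epsilon> k same \<in> {0..1}"
    and above: "\<epsilon>\<^sup>2 * d > (real k)\<^sup>2"
  shows "\<exists>C>0. \<forall>\<^sub>F n in sequentially. \<forall>l::nat. real l \<ge> C * ln (real n) \<longrightarrow>
    max_low_degree_ratio n d \<epsilon> k l \<ge> real n"
proof -
  define \<Lambda> where "\<Lambda> = \<epsilon>\<^sup>2 * d / (real k)\<^sup>2"
  have \<Lambda>: "\<Lambda> > 1" using above k by (simp add: \<Lambda>_def)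
  \<comment> \<open>This makes \<open>\<Lambda> ^ m\<close> at least
    \<open>n ^ 5 / \<Lambda>\<close>. Two powers of \<open>n\<close> pay for the two fixed vertices,
    two are the target for the squared norm, and the fifth absorbs the constant
    \<open>2 * \<Lambda>\<close>.\<close>
  define C where "C = 5 / ln \<Lambda>"
  have C: "C > 0" using \<Lambda> by (simp add: C_def)
  have asymp: "\<forall>\<^sub>F n in sequentially. C * ln (real n) \<ge> 4"
    "\<forall>\<^sub>F n in sequentially. (C * ln (real n))\<^sup>2 \<le> real n / 2"
    "\<forall>\<^sub>F n in sequentially. C * ln (real n) \<le> real n"
    "\<forall>\<^sub>F n in sequentially. real n \<ge> 2 * \<Lambda>"
    using C by real_asymp+
  have "\<forall>\<^sub>F n in sequentially. \<forall>l::nat. real l \<ge> C * ln (real n) \<longrightarrow>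
    max_low_degree_ratio n d \<epsilon> k l \<ge> real n"
    using eventually_max_low_degree_ratio_eq[OF d k prob] asymp
  proof eventually_elim
    case (elim n)
    \<comment> \<open>Rounding down ensures \<open>m \<le> l\<close> for every admissible
      \<open>l\<close>, at the cost of at most one factor \<open>\<Lambda>\<close>.\<close>
    define m where "m = nat \<lfloor>C * ln (real n)\<rfloor>"
    have m_le: "real m \<le> C * ln (real n)" and m_ge: "C * ln (real n) - 1 \<le> real m"
      using elim by (auto simp: m_def)
    have m3: "3 \<le> m" using m_ge elim by linarith
    have mn: "m \<le> n" using m_le elim by linarith
    have n: "real n > 0" using elim \<Lambda> by linarith
    have nd: "real n - d > 0" "real n - d \<le> real n" using elim d by auto
    have "(real m)\<^sup>2 \<le> (C * ln (real n))\<^sup>2" using m_le by (intro power_mono) auto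
    then have m2: "(real m)\<^sup>2 \<le> real n / 2" using elim by linarith
    have "real n ^ 5 / \<Lambda> = \<Lambda> powr (C * ln (real n) - 1)"
    proof -
      have "\<Lambda> powr (C * ln (real n)) = exp (5 * ln (real n))"
        using \<Lambda> by (simp add: powr_def C_def)
      also have "\<dots> = real n ^ 5" using n exp_of_nat_mult[of 5 "ln (real n)"] by simp
      finally show ?thesis using \<Lambda> by (simp add: powr_diff)
    qed
    also have "\<dots> \<le> \<Lambda> powr real m" using m_ge \<Lambda> by (intro powr_mono) auto
    also have "\<dots> = \<Lambda> ^ m" using \<Lambda> by (simp add: powr_realpow)
    finally have \<Lambda>m: "real n ^ 5 / \<Lambda> \<le> \<Lambda> ^ m" .
    \<comment> \<open>By Bernoulli's inequality, since \<open>m^2 \<le> n / 2\<close>: forbidding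
      repeated vertices costs at most a factor 2.\<close>
    have half: "1 / 2 \<le> (1 - real m / real n) ^ (m - 2)"
    proof -
      have "real (m - 2) * (real m / real n) \<le> real m * (real m / real n)" by (intro mult_right_mono) auto
      also have "\<dots> \<le> 1 / 2" using m2 n by (simp add: power2_eq_square divide_le_eq)
      finally have "1 / 2 \<le> 1 + real (m - 2) * (- (real m / real n))" by simp
      also have "\<dots> \<le> (1 + - (real m / real n)) ^ (m - 2)"
        using mn n by (intro Bernoulli_inequality) (simp add: divide_le_eq)
      finally show ?thesis by simp
    qed
    have "(real n)\<^sup>2 \<le> real n ^ 3 / (2 * \<Lambda>)"
      using elim \<Lambda> by (simp add: le_divide_eq power2_eq_square power3_eq_cube mult_left_mono)
    also have "\<dots> = (1 / 2) * (real n ^ 5 / \<Lambda>) / (real n)\<^sup>2"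
      using n \<Lambda> by (simp add: field_simps eval_nat_numeral)
    also have "\<dots> \<le> (1 - real m / real n) ^ (m - 2) * \<Lambda> ^ m / (real n)\<^sup>2"
      using half \<Lambda>m \<Lambda> n by (intro divide_right_mono mult_mono) auto
    also have "\<dots> = real (n - m) ^ (m - 2) * (\<Lambda> / real n) ^ m"
    proof -
      have "m = (m - 2) + 2" using m3 by simp
      then have "real n ^ m = real n ^ (m - 2) * (real n)\<^sup>2" by (metis power_add)
      moreover have "1 - real m / real n = real (n - m) / real n"
        using mn n by (simp add: of_nat_diff diff_divide_distrib)
      ultimately show ?thesis using n by (simp add: power_divide)
    qed
    also have "\<dots> \<le> real (n - m) ^ (m - 2) * (\<Lambda> / (real n - d)) ^ m"
      using nd \<Lambda> by (intro mult_left_mono power_mono divide_left_mono) auto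
    finally have base: "(real n)\<^sup>2 \<le> real (n - m) ^ (m - 2) * (\<Lambda> / (real n - d)) ^ m" .
    show ?case
    proof (intro allI impI)
      fix l :: nat assume "real l \<ge> C * ln (real n)"
      then have "m \<le> l" using m_le by linarith
      then have "(real n)\<^sup>2 \<le> low_degree_norm_sq n k (\<Lambda> / (real n - d)) l"
        using base low_degree_norm_sq_ge[OF k m3 _ mn, of l "\<Lambda> / (real n - d)"] nd \<Lambda> by auto
      then show "real n \<le> max_low_degree_ratio n d \<epsilon> k l"
        using elim by (simp add: \<Lambda>_def real_le_rsqrt)
    qed
  qed
  with C show ?thesis by blast
qed

text \<open>For \<open>l \<le> sqrt n\<close> the Chernoff parameter is of order
  \<open>n powr (- 1 / 4)\<close>, so its error factor tends to 1, as does
  \<open>n / (n - d)\<close>. The gap between \<open>\<Lambda>\<close> and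
  \<open>(1 - \<delta>)^2\<close> then dominates both.\<close>

lemma eventually_max_low_degree_ratio_le:
  fixes d \<epsilon> :: real and l :: "nat \<Rightarrow> nat"
  assumes d: "d > 0" and k: "k \<ge> 2"
    and prob: "\<forall>\<^sub>F n in sequentially. \<forall>same. sbm_edge_prob n d \<epsilon> k same \<in> {0..1}"
    and below: "\<epsilon>\<^sup>2 * d < (real k)\<^sup>2"
    and l: "\<forall>\<^sub>F n in sequentially. real (l n) \<le> sqrt (real n)"
  shows "\<exists>C\<ge>1. \<forall>\<^sub>F n in sequentially. max_low_degree_ratio n d \<epsilon> k (l n) \<le> C * (real (l n) + 1)"
proof -
  define \<Lambda> where "\<Lambda> = \<epsilon>\<^sup>2 * d / (real k)\<^sup>2"
  have \<Lambda>: "0 \<le> \<Lambda>" "\<Lambda> < 1" using below d k by (simp_all add: \<Lambda>_def)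
  \<comment> \<open>Then \<open>1 - \<delta>\<close> is the midpoint of
    \<open>sqrt \<Lambda>\<close> and 1, so the loss from the net stays within the gap below the
    threshold.\<close>
  define \<delta> where "\<delta> = (1 - sqrt \<Lambda>) / 2"
  have sq: "0 \<le> sqrt \<Lambda>" "sqrt \<Lambda> < 1" using \<Lambda> by auto
  then have "0 < \<delta>" by (simp add: \<delta>_def)
  moreover have "- 1 < sqrt \<Lambda>" by (rule less_le_trans[OF _ sq(1)]) simp
  then have "\<delta> < 1" by (simp add: \<delta>_def)
  ultimately have \<delta>: "0 < \<delta>" "\<delta> < 1" by auto
  have "sqrt \<Lambda> < 1 - \<delta>" using sq by (simp add: \<delta>_def field_simps)
  then have \<Lambda>\<delta>: "\<Lambda> < (1 - \<delta>)\<^sup>2" using \<Lambda> power_strict_mono[of "sqrt \<Lambda>" "1 - \<delta>" 2] by simp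
  obtain C :: real where C: "C \<ge> 1"
    "\<And>n l \<rho>. n > 0 \<Longrightarrow> \<rho> \<ge> 0 \<Longrightarrow> sqrt (2 * real l / real n) * real k ^ 3 \<le> 1 \<Longrightarrow>
      \<rho> * real n * exp (2 * sqrt (2 * real l / real n) * real k ^ 3) \<le> (1 - \<delta>)\<^sup>2 \<Longrightarrow>
      low_degree_norm_sq n k \<rho> l \<le> C * (real l + 1)\<^sup>2"
    using low_degree_norm_sq_le[of k \<delta>] k \<delta> by auto
  define r where "r n = sqrt (2 * sqrt (real n) / real n)" for n
  have r: "r \<longlonglongrightarrow> 0" unfolding r_def by real_asymp
  have "(\<lambda>n. r n * real k ^ 3) \<longlonglongrightarrow> 0 * real k ^ 3" by (intro tendsto_intros r)
  then have ev1: "\<forall>\<^sub>F n in sequentially. r n * real k ^ 3 < 1" by (rule order_tendstoD) simp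
  have "(\<lambda>n. real n / (real n - d)) \<longlonglongrightarrow> 1" by real_asymp
  then have "(\<lambda>n. \<Lambda> * (real n / (real n - d)) * exp (2 * r n * real k ^ 3)) \<longlonglongrightarrow>
      \<Lambda> * 1 * exp (2 * 0 * real k ^ 3)"
    by (intro tendsto_intros r)
  then have ev2: "\<forall>\<^sub>F n in sequentially. \<Lambda> * (real n / (real n - d)) * exp (2 * r n * real k ^ 3) < (1 - \<delta>)\<^sup>2"
    by (rule order_tendstoD) (use \<Lambda>\<delta> in simp)
  have "\<forall>\<^sub>F n in sequentially. max_low_degree_ratio n d \<epsilon> k (l n) \<le> sqrt C * (real (l n) + 1)"
    using eventually_max_low_degree_ratio_eq[OF d k prob] ev1 ev2 l
  proof eventually_elim
    case (elim n)
    have n: "n > 0" "real n - d > 0" using elim d by auto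
    have le: "sqrt (2 * real (l n) / real n) \<le> r n"
      using elim n unfolding r_def by (intro real_sqrt_le_mono divide_right_mono) auto
    have "low_degree_norm_sq n k (\<Lambda> / (real n - d)) (l n) \<le> C * (real (l n) + 1)\<^sup>2"
    proof (rule C(2))
      show "\<Lambda> / (real n - d) \<ge> 0" using \<Lambda> n by simp
      have "sqrt (2 * real (l n) / real n) * real k ^ 3 \<le> r n * real k ^ 3"
        using le by (intro mult_right_mono) auto
      then show "sqrt (2 * real (l n) / real n) * real k ^ 3 \<le> 1" using elim by linarith
      have "\<Lambda> / (real n - d) * real n * exp (2 * sqrt (2 * real (l n) / real n) * real k ^ 3) \<le>
          \<Lambda> / (real n - d) * real n * exp (2 * r n * real k ^ 3)"
        using le \<Lambda> n by (intro mult_left_mono) (auto intro!: mult_right_mono)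
      also have "\<dots> = \<Lambda> * (real n / (real n - d)) * exp (2 * r n * real k ^ 3)" by simp
      finally show "\<Lambda> / (real n - d) * real n * exp (2 * sqrt (2 * real (l n) / real n) * real k ^ 3) \<le> (1 - \<delta>)\<^sup>2"
        using elim by linarith
    qed (rule n)
    then have "sqrt (low_degree_norm_sq n k (\<Lambda> / (real n - d)) (l n)) \<le> sqrt (C * (real (l n) + 1)\<^sup>2)"
      by (rule real_sqrt_le_mono)
    then show ?case using elim by (simp add: \<Lambda>_def real_sqrt_mult)
  qed
  with C(1) show ?thesis by (intro exI[of _ "sqrt C"]) simp
qed

theorem theorem1p9:
  fixes d \<epsilon> :: real and k :: nat
  assumes "d > 0" and "\<epsilon> > 0" and "k \<ge> 2"
    and "\<forall>\<^sub>F n in sequentially. \<forall>same. sbm_edge_prob n d \<epsilon> k same \<in> {0..1}"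
  shows "(\<epsilon>\<^sup>2 * d > (real k)\<^sup>2 \<longrightarrow>
           (\<exists>C c. C > 0 \<and> c > 0 \<and>
             (\<forall>\<^sub>F n in sequentially. \<forall>l::nat. real l \<ge> C * ln (real n) \<longrightarrow>
               max_low_degree_ratio n d \<epsilon> k l \<ge> real n powr c)))
       \<and> (\<epsilon>\<^sup>2 * d < (real k)\<^sup>2 \<longrightarrow>
           (\<forall>l :: nat \<Rightarrow> nat. le_n_pow_o1 (\<lambda>n. real (l n)) \<longrightarrow>
             le_n_pow_o1 (\<lambda>n. max_low_degree_ratio n d \<epsilon> k (l n))))"
proof (intro conjI impI allI)
  assume "\<epsilon>\<^sup>2 * d > (real k)\<^sup>2"
  then obtain C where "C > 0" "\<forall>\<^sub>F n in sequentially. \<forall>l::nat. real l \<ge> C * ln (real n) \<longrightarrow>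
      max_low_degree_ratio n d \<epsilon> k l \<ge> real n"
    using eventually_max_low_degree_ratio_ge assms by blast
  then show "\<exists>C c. C > 0 \<and> c > 0 \<and>
      (\<forall>\<^sub>F n in sequentially. \<forall>l::nat. real l \<ge> C * ln (real n) \<longrightarrow>
        max_low_degree_ratio n d \<epsilon> k l \<ge> real n powr c)"
    by (intro exI[of _ C] exI[of _ 1]) simp
next
  fix l :: "nat \<Rightarrow> nat"
  assume below: "\<epsilon>\<^sup>2 * d < (real k)\<^sup>2" and "le_n_pow_o1 (\<lambda>n. real (l n))"
  then obtain \<delta> where \<delta>: "\<delta> \<longlonglongrightarrow> 0" and l: "\<forall>\<^sub>F n in sequentially. real (l n) \<le> real n powr \<delta> n"
    unfolding le_n_pow_o1_def by blast
  \<comment> \<open>Of the growth condition on \<open>l\<close>, the norm bound uses only that the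
    exponent is eventually below \<open>1 / 2\<close>.\<close>
  have "\<forall>\<^sub>F n in sequentially. \<delta> n < 1 / 2" using \<delta> by (rule order_tendstoD) simp
  then have "\<forall>\<^sub>F n in sequentially. real (l n) \<le> sqrt (real n)"
    using l eventually_ge_at_top[of 1]
  proof eventually_elim
    case (elim n)
    then have "real n powr \<delta> n \<le> real n powr (1 / 2)" by (intro powr_mono) auto
    with elim show ?case by (simp add: powr_half_sqrt)
  qed
  then obtain C where C: "C \<ge> 1"
    "\<forall>\<^sub>F n in sequentially. max_low_degree_ratio n d \<epsilon> k (l n) \<le> C * (real (l n) + 1)"
    using eventually_max_low_degree_ratio_le[OF assms(1,3,4) below] by blast
  \<comment> \<open>The maximum with 0 keeps the power of \<open>n\<close> at least 1, so that
    \<open>l + 1\<close> is at most twice that power; the second summand expresses the constant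
    \<open>2 * C\<close> as a power of \<open>n\<close> with vanishing exponent.\<close>
  let ?\<delta> = "\<lambda>n. max (\<delta> n) 0 + ln (2 * C) / ln (real n)"
  have "(\<lambda>n. ln (2 * C) / ln (real n)) \<longlonglongrightarrow> 0" by real_asymp
  then have "?\<delta> \<longlonglongrightarrow> max 0 0 + 0" by (intro tendsto_intros \<delta>)
  moreover have "\<forall>\<^sub>F n in sequentially. max_low_degree_ratio n d \<epsilon> k (l n) \<le> real n powr ?\<delta> n"
    using C(2) l eventually_ge_at_top[of 2]
  proof eventually_elim
    case (elim n)
    have "real n powr \<delta> n \<le> real n powr max (\<delta> n) 0" "1 \<le> real n powr max (\<delta> n) 0"
      using elim by (auto intro!: powr_mono ge_one_powr_ge_zero)
    with elim have "real (l n) + 1 \<le> 2 * real n powr max (\<delta> n) 0" by linarith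
    then have "C * (real (l n) + 1) \<le> C * (2 * real n powr max (\<delta> n) 0)"
      using C(1) by (intro mult_left_mono) auto
    also have "\<dots> = real n powr ?\<delta> n"
      using elim C(1) by (simp add: powr_add) (simp add: powr_def)
    finally show ?case using elim by linarith
  qed
  ultimately show "le_n_pow_o1 (\<lambda>n. max_low_degree_ratio n d \<epsilon> k (l n))"
    unfolding le_n_pow_o1_def by (intro exI[of _ ?\<delta>]) simp
qed

end
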